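(* Let $\alpha\in(0,1]$, let $t_0=0$ and $T_0>t_0$, and let $\psi:[t_0,\infty)\to[0,\infty)$ be strictly increasing, of class $C^1$, with $\psi'>0$. Let $g:[t_0,T_0]\times\mathbb{R}^d\to\mathbb{R}^d$ be Lipschitz continuous, and let $x$ be a solution on $[t_0,T_0]$ of $${}^{C}D_{t_0,\psi}^{\alpha}x(t)=g(t,x(t)),\qquad x(t_0)=x_0\in\mathbb{R}^d,$$ such that $t\mapsto g(t,x(t))$ is twice continuously differentiable on $[t_0,T_0]$. Then, for a suitably chosen $T\in(t_0,T_0]$, the Adams-Bashforth-Moulton predictor-corrector approximations $x_k$ on the uniform grid $t_k=t_0+kh$ of $[t_0,T]$ with step size $h>0$ satisfy $$\|x(t_k)-x_k\|=O(h^{1+\alpha}),$$ i.e. there is a constant $C$, independent of $h$ and $k$, such that $\|x(t_k)-x_k\|\le Ch^{1+\alpha}$ for all $k$ with $t_k\le T$.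
   Context: For $0<\gamma\le 1$, $(I_{a,\psi}^{\gamma}x)(t)=\frac{1}{\Gamma(\gamma)}\int_a^t(\psi(t)-\psi(\tau))^{\gamma-1}\psi'(\tau)x(\tau)\,d\tau$, $I_{a,\psi}^{0}$ is the identity, and the $\psi$-Caputo derivative is ${}^{C}D_{a,\psi}^{\alpha}=I_{a,\psi}^{1-\alpha}\circ J_\psi$ with $J_\psi=\frac{1}{\psi'(t)}\frac{d}{dt}$ (componentwise for vector functions). A solution $x$ is continuous, and equivalently satisfies $x(t)=x_0+\frac{1}{\Gamma(\alpha)}\int_{t_0}^t(\psi(t)-\psi(s))^{\alpha-1}\psi'(s)g(s,x(s))\,ds$. The Adams-Bashforth-Moulton (ABM) scheme: given $x_0,\dots,x_k$, the predictor is $$x^P_{k+1}=x_0+\frac{1}{\Gamma(\alpha)}\sum_{i=0}^{k}b_{i,k+1}\,g(t_i,x_i),\qquad b_{i,k+1}=\int_{t_i}^{t_{i+1}}(\psi(t_{k+1})-\psi(\tau))^{\alpha-1}\psi'(\tau)\,d\tau,$$ and the corrector is $$x_{k+1}=x_0+\frac{1}{\Gamma(\alpha)}\Big(\sum_{i=0}^{k}a_{i,k+1}\,g(t_i,x_i)+a_{k+1,k+1}\,g(t_{k+1},x^P_{k+1})\Big),$$ $$a_{i,k+1}=\int_{t_0}^{t_{k+1}}(\psi(t_{k+1})-\psi(\tau))^{\alpha-1}\psi'(\tau)\,\phi_{i,k+1}(\tau)\,d\tau,$$ where $\phi_{i,k+1}$ is the piecewise linear hat function on the grid $t_0<\dots<t_{k+1}$: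 $\phi_{i,k+1}(\tau)=\frac{\tau-t_{i-1}}{t_i-t_{i-1}}$ for $t_{i-1}<\tau\le t_i$ (when $i\ge1$), $\phi_{i,k+1}(\tau)=\frac{t_{i+1}-\tau}{t_{i+1}-t_i}$ for $t_i<\tau\le t_{i+1}$ (when $i\le k$), and $0$ otherwise. $\|\cdot\|$ is the Euclidean norm. *)

theory Defs
  imports "HOL-Analysis.Analysis"
begin

text \<open>
  Throughout, \<open>psi'\<close> stands for the derivative of \<open>psi\<close>; the theorem assumes this relation.
  Vector-valued integrals and derivatives are taken componentwise by the library.
\<close>

definition psi_kernel ::
    "(real \<Rightarrow> real) \<Rightarrow> (real \<Rightarrow> real) \<Rightarrow> real \<Rightarrow> real \<Rightarrow> real \<Rightarrow> real" where
  "psi_kernel psi psi' \<gamma> t \<tau> = (psi t - psi \<tau>) powr (\<gamma> - 1) * psi' \<tau>"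

definition psi_integral ::
    "real \<Rightarrow> (real \<Rightarrow> real) \<Rightarrow> (real \<Rightarrow> real) \<Rightarrow> real \<Rightarrow> (real \<Rightarrow> 'a::euclidean_space) \<Rightarrow> real \<Rightarrow> 'a" where
  "psi_integral a psi psi' \<gamma> x t =
     (if \<gamma> = 0 then x t
      else (1 / Gamma \<gamma>) *\<^sub>R integral {a..t} (\<lambda>\<tau>. psi_kernel psi psi' \<gamma> t \<tau> *\<^sub>R x \<tau>))"

text \<open>The integral defining \<open>psi_integral\<close> exists in the sense of Lebesgue.\<close>

definition psi_integrable ::
    "real \<Rightarrow> (real \<Rightarrow> real) \<Rightarrow> (real \<Rightarrow> real) \<Rightarrow> real \<Rightarrow> (real \<Rightarrow> 'a::euclidean_space) \<Rightarrow> real \<Rightarrow> bool" where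
  "psi_integrable a psi psi' \<gamma> x t \<longleftrightarrow>
     \<gamma> = 0 \<or> (\<lambda>\<tau>. psi_kernel psi psi' \<gamma> t \<tau> *\<^sub>R x \<tau>) absolutely_integrable_on {a..t}"

text \<open>
  \<open>J\<^sub>\<psi>\<close> for functions on the interval \<open>{a..b}\<close>; the derivative is one-sided at the end points.
\<close>

definition psi_deriv ::
    "real \<Rightarrow> real \<Rightarrow> (real \<Rightarrow> real) \<Rightarrow> (real \<Rightarrow> 'a::euclidean_space) \<Rightarrow> real \<Rightarrow> 'a" where
  "psi_deriv a b psi' x t = (1 / psi' t) *\<^sub>R vector_derivative x (at t within {a..b})"

definition psi_caputo ::
    "real \<Rightarrow> real \<Rightarrow> (real \<Rightarrow> real) \<Rightarrow> (real \<Rightarrow> real) \<Rightarrow> real \<Rightarrow> (real \<Rightarrow> 'a::euclidean_space) \<Rightarrow> real \<Rightarrow> 'a" where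
  "psi_caputo a b psi psi' \<alpha> x = psi_integral a psi psi' (1 - \<alpha>) (psi_deriv a b psi' x)"

text \<open>
  Solutions of the initial value problem on \<open>{a..b}\<close>.  Differentiability and the equation are
  required on \<open>{a<..b}\<close> only: solutions typically behave like \<open>(\<psi> t - \<psi> a) powr \<alpha>\<close> near \<open>a\<close>, so
  they are not differentiable there, and for \<open>\<alpha> < 1\<close> the integral defining the Caputo
  derivative at \<open>a\<close> itself ranges over a single point.  The initial point is covered by
  continuity and the initial value.
\<close>

definition psi_caputo_solution ::
    "real \<Rightarrow> (real \<Rightarrow> real) \<Rightarrow> (real \<Rightarrow> real) \<Rightarrow> (real \<times> 'a \<Rightarrow> 'a) \<Rightarrow> real \<Rightarrow> real \<Rightarrow> 'a \<Rightarrow>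
     (real \<Rightarrow> 'a::euclidean_space) \<Rightarrow> bool" where
  "psi_caputo_solution \<alpha> psi psi' g a b x0 x \<longleftrightarrow>
     continuous_on {a..b} x \<and>
     x a = x0 \<and>
     (\<forall>t\<in>{a<..b}.
        x differentiable (at t within {a..b}) \<and>
        psi_integrable a psi psi' (1 - \<alpha>) (psi_deriv a b psi' x) t \<and>
        psi_caputo a b psi psi' \<alpha> x t = g (t, x t))"

definition C2_on :: "real set \<Rightarrow> (real \<Rightarrow> 'a::real_normed_vector) \<Rightarrow> bool" where
  "C2_on S f \<longleftrightarrow>
     (\<exists>f' f''. (\<forall>t\<in>S. (f has_vector_derivative f' t) (at t within S)) \<and>
               (\<forall>t\<in>S. (f' has_vector_derivative f'' t) (at t within S)) \<and>
               continuous_on S f'')"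

text \<open>The hat function \<open>\<phi>\<^bsub>i,n\<^esub>\<close> on the grid \<open>t 0 < \<dots> < t n\<close>.\<close>

definition hat :: "(nat \<Rightarrow> real) \<Rightarrow> nat \<Rightarrow> nat \<Rightarrow> real \<Rightarrow> real" where
  "hat t i n \<tau> =
     (if 1 \<le> i \<and> t (i - 1) < \<tau> \<and> \<tau> \<le> t i then (\<tau> - t (i - 1)) / (t i - t (i - 1))
      else if i < n \<and> t i < \<tau> \<and> \<tau> \<le> t (i + 1) then (t (i + 1) - \<tau>) / (t (i + 1) - t i)
      else 0)"

definition predictor_weight ::
    "real \<Rightarrow> (real \<Rightarrow> real) \<Rightarrow> (real \<Rightarrow> real) \<Rightarrow> (nat \<Rightarrow> real) \<Rightarrow> nat \<Rightarrow> nat \<Rightarrow> real" where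
  "predictor_weight \<alpha> psi psi' t i n = integral {t i..t (i + 1)} (psi_kernel psi psi' \<alpha> (t n))"

definition corrector_weight ::
    "real \<Rightarrow> (real \<Rightarrow> real) \<Rightarrow> (real \<Rightarrow> real) \<Rightarrow> (nat \<Rightarrow> real) \<Rightarrow> nat \<Rightarrow> nat \<Rightarrow> real" where
  "corrector_weight \<alpha> psi psi' t i n =
     integral {t 0..t n} (\<lambda>\<tau>. psi_kernel psi psi' \<alpha> (t n) \<tau> * hat t i n \<tau>)"

fun abm ::
    "real \<Rightarrow> (real \<Rightarrow> real) \<Rightarrow> (real \<Rightarrow> real) \<Rightarrow> (real \<times> 'a \<Rightarrow> 'a) \<Rightarrow> (nat \<Rightarrow> real) \<Rightarrow> 'a \<Rightarrow> nat \<Rightarrow>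
     'a::euclidean_space" where
  "abm \<alpha> psi psi' g t x0 0 = x0"
| "abm \<alpha> psi psi' g t x0 (Suc k) =
     (let xP = x0 + (1 / Gamma \<alpha>) *\<^sub>R
                 (\<Sum>i\<in>{0..k}. predictor_weight \<alpha> psi psi' t i (k + 1) *\<^sub>R
                                g (t i, abm \<alpha> psi psi' g t x0 i))
      in x0 + (1 / Gamma \<alpha>) *\<^sub>R
           ((\<Sum>i\<in>{0..k}. corrector_weight \<alpha> psi psi' t i (k + 1) *\<^sub>R
                            g (t i, abm \<alpha> psi psi' g t x0 i))
            + corrector_weight \<alpha> psi psi' t (k + 1) (k + 1) *\<^sub>R g (t (k + 1), xP)))"

definition uniform_grid :: "real \<Rightarrow> real \<Rightarrow> nat \<Rightarrow> real" where
  "uniform_grid t0 h k = t0 + real k * h"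

end

theory Submission
  imports Defs
begin

text \<open>
  The scheme converges because the differential equation is a Volterra equation with an integrable
  kernel, and predictor and corrector are product integration rules for that kernel.

  Put \<open>z t = g (t, x t)\<close>. A solution satisfies \<open>x = x0 + I\<^sup>\<alpha> z\<close>
  (\<open>caputo_solution_integral_equation\<close>): by the semigroup law \<open>I\<^sup>\<beta> I\<^sup>\<gamma> = I\<^sup>\<beta>\<^sup>+\<^sup>\<gamma>\<close>
  (\<open>psi_integral_compose\<close>, that is, Fubini and Euler's Beta integral), applying \<open>I\<^sup>\<alpha>\<close> to
  \<open>I\<^sup>1\<^sup>-\<^sup>\<alpha> (x' / \<psi>') = z\<close> leaves the ordinary integral of \<open>x'\<close>.

  The corrector integrates the piecewise linear interpolant of \<open>z\<close> exactly against the kernel. As \<open>z\<close> is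
  twice continuously differentiable, the interpolation error is \<open>O(h\<^sup>2)\<close>, and so is the quadrature
  error, the kernel having a bounded integral. The predictor integrates a step function and is
  accurate only to \<open>O(h)\<close>, but its value enters the corrector with a weight that integrates
  the kernel over a single cell, hence of size \<open>O(h powr \<alpha>)\<close>. Together the local error is
  \<open>O(h\<^sup>2 + h powr (1 + \<alpha>)) = O(h powr (1 + \<alpha>))\<close>.

  Errors of earlier values are propagated with nonnegative weights whose sum is at most
  \<open>(\<psi> T - \<psi> a) powr \<alpha> / \<Gamma> (\<alpha> + 1)\<close>. Choosing \<open>T\<close> so close to \<open>a\<close> that this sum times the Lipschitz
  constant is at most \<open>1/4\<close> turns the error recursion (\<open>abm_step_error\<close>) into a contraction, and
  the bound follows by strong induction on the step number (\<open>abm_error_bound\<close>).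
\<close>

section \<open>The \<psi>-kernel and its integrals\<close>

locale time_change =
  fixes a :: real and psi psi' :: "real \<Rightarrow> real"
  assumes psi_strict_mono: "strict_mono_on {a..} psi"
    and psi_has_deriv: "\<And>t. t \<ge> a \<Longrightarrow> (psi has_real_derivative psi' t) (at t within {a..})"
    and psi'_cont: "continuous_on {a..} psi'"
    and psi'_pos: "\<And>t. t \<ge> a \<Longrightarrow> psi' t > 0"
begin

lemma psi_less: "a \<le> s \<Longrightarrow> s < t \<Longrightarrow> psi s < psi t"
  using psi_strict_mono by (auto simp: strict_mono_on_def)

lemma psi_le: "a \<le> s \<Longrightarrow> s \<le> t \<Longrightarrow> psi s \<le> psi t"
  using psi_less[of s t] by (cases "s = t") auto

lemma psi_cont: "continuous_on {a..} psi"
  using psi_has_deriv by (meson DERIV_continuous_on atLeast_iff)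

lemma psi_cont_Icc: "a \<le> c \<Longrightarrow> continuous_on {c..d} psi"
  by (rule continuous_on_subset[OF psi_cont]) auto

lemma psi'_cont_Icc: "a \<le> c \<Longrightarrow> continuous_on {c..d} psi'"
  by (rule continuous_on_subset[OF psi'_cont]) auto

lemma psi_has_deriv_at:
  assumes "a < t"
  shows "(psi has_real_derivative psi' t) (at t)"
proof -
  have "t \<in> interior {a..}" using assms by simp
  then have "at t within {a..} = at t" by (rule at_within_interior)
  then show ?thesis using psi_has_deriv[of t] assms by simp
qed

lemma kernel_nonneg: "a \<le> \<tau> \<Longrightarrow> 0 \<le> psi_kernel psi psi' \<gamma> t \<tau>"
  using psi'_pos[of \<tau>] by (simp add: psi_kernel_def)

text \<open>
  The substitution \<open>u = \<psi> t - \<psi> \<tau>\<close> turns the kernel into \<open>u powr (\<gamma> - 1)\<close>, so an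
  antiderivative is explicit. It is continuous up to \<open>\<tau> = t\<close>, where the kernel is singular for
  \<open>\<gamma> < 1\<close>; hence the form of the fundamental theorem that differentiates only in the interior.
\<close>

lemma kernel_has_integral:
  assumes "0 < \<gamma>" "a \<le> c" "c \<le> d" "d \<le> t"
  shows "(psi_kernel psi psi' \<gamma> t has_integral
           ((psi t - psi c) powr \<gamma> - (psi t - psi d) powr \<gamma>) / \<gamma>) {c..d}"
proof -
  let ?F = "\<lambda>\<tau>. - ((psi t - psi \<tau>) powr \<gamma> / \<gamma>)"
  have "(psi_kernel psi psi' \<gamma> t has_integral (?F d - ?F c)) {c..d}"
  proof (rule fundamental_theorem_of_calculus_interior[OF \<open>c \<le> d\<close>])
    show "continuous_on {c..d} ?F"
      using assms
      by (intro continuous_intros continuous_on_powr' psi_cont_Icc ballI) (auto intro!: psi_le)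
    fix \<tau> assume \<tau>: "\<tau> \<in> {c<..<d}"
    have "psi \<tau> < psi t" using \<tau> assms by (intro psi_less) auto
    then have "(?F has_real_derivative psi_kernel psi psi' \<gamma> t \<tau>) (at \<tau>)"
      using \<tau> assms unfolding psi_kernel_def
      by (auto intro!: derivative_eq_intros psi_has_deriv_at simp: field_simps)
    then show "(?F has_vector_derivative psi_kernel psi psi' \<gamma> t \<tau>) (at \<tau>)"
      by (simp add: has_real_derivative_iff_has_vector_derivative)
  qed
  then show ?thesis by (simp add: diff_divide_distrib)
qed

lemma kernel_abs_integrable:
  assumes "0 < \<gamma>" "a \<le> c" "d \<le> t"
  shows "psi_kernel psi psi' \<gamma> t absolutely_integrable_on {c..d}"
proof (cases "c \<le> d")
  case True
  then show ?thesis
    using kernel_has_integral[of \<gamma> c d t] assms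
    by (intro nonnegative_absolutely_integrable_1 kernel_nonneg) auto
qed auto

lemma kernel_mult_abs_integrable:
  fixes f :: "real \<Rightarrow> 'a::euclidean_space"
  assumes "0 < \<gamma>" "a \<le> c" "d \<le> t"
    and "f \<in> borel_measurable (lebesgue_on {c..d})" "bounded (f ` {c..d})"
  shows "(\<lambda>\<tau>. psi_kernel psi psi' \<gamma> t \<tau> *\<^sub>R f \<tau>) absolutely_integrable_on {c..d}"
proof -
  have "bilinear (\<lambda>(u::'a) (r::real). r *\<^sub>R u)"
    by (auto simp: bilinear_def intro!: linearI simp: algebra_simps)
  from absolutely_integrable_bounded_measurable_product[OF this assms(4) _ assms(5)
      kernel_abs_integrable[OF assms(1-3)]]
  show ?thesis by simp
qed

lemma kernel_mult_continuous_abs_integrable: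
  fixes f :: "real \<Rightarrow> 'a::euclidean_space"
  assumes "0 < \<gamma>" "a \<le> c" "d \<le> t" "continuous_on {c..d} f"
  shows "(\<lambda>\<tau>. psi_kernel psi psi' \<gamma> t \<tau> *\<^sub>R f \<tau>) absolutely_integrable_on {c..d}"
  using assms
  by (intro kernel_mult_abs_integrable continuous_imp_measurable_on_sets_lebesgue
      compact_imp_bounded compact_continuous_image) auto

text \<open>
  Substituting \<open>u = (\<psi> s - \<psi> \<tau>) / (\<psi> t - \<psi> \<tau>)\<close> maps the interval to the unit interval and gives
  Euler's Beta integral. This is the inner integral that appears when two fractional integrals
  are composed.
\<close>

lemma Beta_kernel_has_integral:
  assumes "0 < \<beta>" "0 < \<gamma>" "a \<le> \<tau>" "\<tau> < t"
  shows "(\<lambda>s. psi_kernel psi psi' \<beta> t s * (psi s - psi \<tau>) powr (\<gamma> - 1))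
           absolutely_integrable_on {\<tau>..t}"
    and "integral {\<tau>..t} (\<lambda>s. psi_kernel psi psi' \<beta> t s * (psi s - psi \<tau>) powr (\<gamma> - 1))
         = Beta \<beta> \<gamma> * (psi t - psi \<tau>) powr (\<beta> + \<gamma> - 1)"
proof -
  define D where "D = psi t - psi \<tau>"
  have D: "D > 0" using psi_less[of \<tau> t] assms by (simp add: D_def)
  define u where "u = (\<lambda>s. (psi s - psi \<tau>) / D)"
  let ?f = "\<lambda>v::real. v powr (\<gamma> - 1) * (1 - v) powr (\<beta> - 1)"
  let ?g = "\<lambda>s. psi_kernel psi psi' \<beta> t s * (psi s - psi \<tau>) powr (\<gamma> - 1)"
  have beta: "(?f has_integral Beta \<gamma> \<beta>) {0..1}"
    by (rule has_integral_Beta_real) (use assms in auto)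
  have "?f absolutely_integrable_on {0..1}"
    using beta by (intro nonnegative_absolutely_integrable_1) auto
  moreover have "u ` {\<tau>..t} = {0..1}"
  proof
    show "u ` {\<tau>..t} \<subseteq> {0..1}"
      using D assms by (auto simp: u_def D_def divide_simps intro!: psi_le)
    have "connected (u ` {\<tau>..t})"
      unfolding u_def using D assms
      by (intro connected_continuous_image continuous_intros psi_cont_Icc) auto
    moreover have "0 \<in> u ` {\<tau>..t}" "1 \<in> u ` {\<tau>..t}"
      using D assms by (auto simp: u_def D_def intro!: image_eqI[of _ _ \<tau>] image_eqI[of _ _ t])
    ultimately show "{0..1} \<subseteq> u ` {\<tau>..t}" by (meson connected_contains_Icc)
  qed
  ultimately have "?f absolutely_integrable_on (u ` {\<tau>..t}) \<and> integral (u ` {\<tau>..t}) ?f = Beta \<gamma> \<beta>"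
    using beta by (auto simp: integral_unique)
  moreover have "(u has_field_derivative psi' s / D) (at s within {\<tau>..t})" if "s \<in> {\<tau>..t}" for s
    unfolding u_def using that assms D
    by (auto intro!: derivative_eq_intros DERIV_subset[OF psi_has_deriv])
  moreover have "inj_on u {\<tau>..t}"
  proof (rule inj_onI)
    fix r s assume rs: "r \<in> {\<tau>..t}" "s \<in> {\<tau>..t}" "u r = u s"
    then have "psi r = psi s" using D by (simp add: u_def)
    then show "r = s" using psi_less[of r s] psi_less[of s r] rs assms by force
  qed
  ultimately have *: "(\<lambda>s. \<bar>psi' s / D\<bar> * ?f (u s)) absolutely_integrable_on {\<tau>..t} \<and>
       integral {\<tau>..t} (\<lambda>s. \<bar>psi' s / D\<bar> * ?f (u s)) = Beta \<gamma> \<beta>"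
    by (subst has_absolute_integral_change_of_variables_1') auto
  \<comment> \<open>Each of the three factors \<open>du\<close>, \<open>u powr (\<gamma> - 1)\<close>, \<open>(1 - u) powr (\<beta> - 1)\<close> releases a power of \<open>D\<close>.\<close>
  define c where "c = D powr (\<beta> + \<gamma> - 1)"
  have eq: "?g s = c * (\<bar>psi' s / D\<bar> * ?f (u s))" if "s \<in> {\<tau>..t}" for s
  proof -
    have nonneg: "0 \<le> psi s - psi \<tau>" "0 \<le> psi t - psi s" "0 < psi' s"
      using that assms by (auto intro!: psi_le psi'_pos)
    have "1 - u s = (psi t - psi s) / D" using D by (simp add: u_def D_def field_simps)
    then have "?f (u s) = (psi s - psi \<tau>) powr (\<gamma> - 1) * (psi t - psi s) powr (\<beta> - 1)
                 / (D powr (\<gamma> - 1) * D powr (\<beta> - 1))"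
      using nonneg D by (simp add: u_def powr_divide)
    moreover have "c = D * (D powr (\<gamma> - 1) * D powr (\<beta> - 1))"
    proof -
      have "D * (D powr (\<gamma> - 1) * D powr (\<beta> - 1)) = D powr 1 * (D powr (\<gamma> - 1) * D powr (\<beta> - 1))"
        using D by simp
      also have "\<dots> = c" unfolding c_def powr_add[symmetric] by (simp add: algebra_simps)
      finally show ?thesis by simp
    qed
    ultimately show ?thesis using nonneg D by (simp add: psi_kernel_def)
  qed
  have "(\<lambda>s. c * (\<bar>psi' s / D\<bar> * ?f (u s))) absolutely_integrable_on {\<tau>..t}"
    using * by (intro set_integrable_mult_right) auto
  then show "?g absolutely_integrable_on {\<tau>..t}"
    by (subst set_integrable_cong[OF refl refl eq]) auto
  have "integral {\<tau>..t} ?g = integral {\<tau>..t} (\<lambda>s. c * (\<bar>psi' s / D\<bar> * ?f (u s)))"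
    by (rule integral_cong) (rule eq)
  also have "\<dots> = c * Beta \<gamma> \<beta>"
    by (simp only: integral_mult_right conjunct2[OF *])
  finally show "integral {\<tau>..t} ?g = Beta \<beta> \<gamma> * (psi t - psi \<tau>) powr (\<beta> + \<gamma> - 1)"
    by (simp add: c_def D_def Beta_commute mult.commute)
qed

end

section \<open>Composition of fractional integrals and the integral equation\<close>

text \<open>
  Absolute integrability of a derivative gives its Lebesgue measurability, so the exchange of
  integrals below takes place over the square of the completed measure; \<sigma>-finiteness is what
  Fubini's theorem asks of each factor.
\<close>

lemma sigma_finite_lebesgue: "sigma_finite_measure (lebesgue :: 'a::euclidean_space measure)"
proof
  obtain A :: "nat \<Rightarrow> 'a set"
    where A: "range A \<subseteq> sets lborel" "(\<Union>i. A i) = space lborel" "\<And>i. emeasure lborel (A i) \<noteq> \<infinity>"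
    using lborel.sigma_finite by metis
  then show "\<exists>A. countable A \<and> A \<subseteq> sets (lebesgue :: 'a measure) \<and> \<Union>A = space lebesgue \<and>
               (\<forall>x\<in>A. emeasure lebesgue x \<noteq> \<infinity>)"
    by (intro exI[of _ "range A"]) (auto simp: subset_iff)
qed

context time_change
begin

text \<open>
  The semigroup law. Writing the left side as a double integral over \<open>a < \<tau> < s < t\<close> and
  integrating first over \<open>s\<close> leaves the Beta integral times the kernel of order \<open>\<beta> + \<gamma>\<close>, and
  \<open>Beta \<beta> \<gamma> / (\<Gamma> \<beta> \<Gamma> \<gamma>) = 1 / \<Gamma> (\<beta> + \<gamma>)\<close>. Absolute integrability at order \<open>\<beta> + \<gamma>\<close> is exactly what
  makes the double integral converge absolutely, by Tonelli.
\<close>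

theorem psi_integral_compose:
  fixes y :: "real \<Rightarrow> 'a::euclidean_space"
  assumes "0 < \<beta>" "0 < \<gamma>"
    and W: "(\<lambda>\<tau>. psi_kernel psi psi' (\<beta> + \<gamma>) t \<tau> *\<^sub>R y \<tau>) absolutely_integrable_on {a..t}"
  shows "psi_integral a psi psi' \<beta> (psi_integral a psi psi' \<gamma> y) t
           = psi_integral a psi psi' (\<beta> + \<gamma>) y t"
proof -
  \<comment> \<open>The integrand is factored as a nonnegative scalar \<open>k\<close> times the integrable function \<open>w\<close>, so that the
    inner integral of \<open>k\<close> is the same constant for all \<open>\<tau>\<close> between \<open>a\<close> and \<open>t\<close>; \<open>P\<close> and \<open>P'\<close>
    extend \<open>\<psi>\<close> and its derivative constantly to the left of \<open>a\<close>, which makes them Borel on the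
    whole line.\<close>
  define w where "w = (\<lambda>\<tau>. indicator {a..t} \<tau> *\<^sub>R (psi_kernel psi psi' (\<beta> + \<gamma>) t \<tau> *\<^sub>R y \<tau>))"
  define P where "P = (\<lambda>s. psi (max a s))"
  define P' where "P' = (\<lambda>s. psi' (max a s))"
  define k where "k = (\<lambda>\<tau> s. if a < \<tau> \<and> \<tau> < s \<and> s < t
     then (P t - P s) powr (\<beta> - 1) * P' s * (P s - P \<tau>) powr (\<gamma> - 1)
            / (P t - P \<tau>) powr (\<beta> + \<gamma> - 1) else 0)"
  define F where "F = (\<lambda>\<tau> s. k \<tau> s *\<^sub>R w \<tau>)"
  have w_int: "integrable lebesgue w"
    using W by (simp add: w_def set_integrable_def)
  have w_integral: "integral\<^sup>L lebesgue w
      = integral {a..t} (\<lambda>\<tau>. psi_kernel psi psi' (\<beta> + \<gamma>) t \<tau> *\<^sub>R y \<tau>)"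
    using set_lebesgue_integral_eq_integral(2)[OF W]
    by (simp add: w_def set_lebesgue_integral_def)
  interpret lebesgue: sigma_finite_measure "lebesgue :: real measure"
    by (rule sigma_finite_lebesgue)
  interpret pair: pair_sigma_finite "lebesgue :: real measure" "lebesgue :: real measure"
    by unfold_locales

  have P_eq: "P s = psi s" "P' s = psi' s" if "a \<le> s" for s
    using that by (auto simp: P_def P'_def max_def)
  have [measurable]: "P \<in> borel_measurable borel" "P' \<in> borel_measurable borel"
    unfolding P_def P'_def
    by (intro borel_measurable_continuous_onI continuous_on_compose2[OF psi_cont]
          continuous_on_compose2[OF psi'_cont] continuous_intros; force)+
  have k_borel: "case_prod k \<in> borel_measurable (borel \<Otimes>\<^sub>M borel)"
    unfolding k_def by measurable
  \<comment> \<open>\<open>k\<close> is Borel in two variables, which is transferred to the product of the completed measures.\<close>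
  have ident: "(\<lambda>x::real. x) \<in> lebesgue \<rightarrow>\<^sub>M borel"
    by (rule measurable_completion) simp
  have "(\<lambda>p. (fst p, snd p)) \<in> lebesgue \<Otimes>\<^sub>M lebesgue \<rightarrow>\<^sub>M (borel \<Otimes>\<^sub>M borel :: (real \<times> real) measure)"
    by (intro measurable_Pair measurable_compose[OF measurable_fst ident]
        measurable_compose[OF measurable_snd ident])
  from measurable_compose[OF this k_borel]
  have [measurable]: "case_prod k \<in> borel_measurable (lebesgue \<Otimes>\<^sub>M lebesgue)"
    by simp
  have [measurable]: "w \<in> borel_measurable lebesgue" using w_int by auto
  have F_meas: "case_prod F \<in> borel_measurable (lebesgue \<Otimes>\<^sub>M lebesgue)"
    unfolding F_def by (simp add: case_prod_beta') measurable

  have k_inner: "integrable lebesgue (k \<tau>)"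
      "integral\<^sup>L lebesgue (k \<tau>) = Beta \<beta> \<gamma>" if \<tau>: "a < \<tau>" "\<tau> < t" for \<tau>
  proof -
    define c where "c = (psi t - psi \<tau>) powr (\<beta> + \<gamma> - 1)"
    have "c > 0" using psi_less[of \<tau> t] \<tau> by (simp add: c_def)
    let ?B = "\<lambda>s. psi_kernel psi psi' \<beta> t s * (psi s - psi \<tau>) powr (\<gamma> - 1)"
    have k_eq: "k \<tau> = (\<lambda>s. (1 / c) * (indicator {\<tau>..t} s *\<^sub>R ?B s))"
      using \<tau> by (auto simp: k_def c_def P_eq psi_kernel_def indicator_def not_less fun_eq_iff
                  dest!: antisym)
    note B = Beta_kernel_has_integral[OF assms(1,2) less_imp_le[OF \<tau>(1)] \<tau>(2)]
    show "integrable lebesgue (k \<tau>)"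
      unfolding k_eq using B(1) by (intro integrable_mult_right) (simp add: set_integrable_def)
    have "integral\<^sup>L lebesgue (k \<tau>) = (1 / c) * (LINT s:{\<tau>..t}|lebesgue. ?B s)"
      unfolding k_eq set_lebesgue_integral_def by simp
    also have "\<dots> = Beta \<beta> \<gamma>"
      using B(2) \<open>c > 0\<close> set_lebesgue_integral_eq_integral(2)[OF B(1)] by (simp add: c_def)
    finally show "integral\<^sup>L lebesgue (k \<tau>) = Beta \<beta> \<gamma>" .
  qed
  have k_zero: "k \<tau> = (\<lambda>s. 0)" if "\<not> (a < \<tau> \<and> \<tau> < t)" for \<tau>
    using that by (auto simp: k_def fun_eq_iff)
  have k_nonneg: "k \<tau> s \<ge> 0" for \<tau> s
    using psi'_pos[of s] by (auto simp: k_def P_eq)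
  have F_inner: "(\<integral>s. F \<tau> s \<partial>lebesgue) = (Beta \<beta> \<gamma> * indicator {a<..<t} \<tau>) *\<^sub>R w \<tau>" for \<tau>
    using k_inner[of \<tau>] k_zero[of \<tau>] by (cases "a < \<tau> \<and> \<tau> < t") (auto simp: F_def)
  have F_inner_norm:
    "(\<integral>s. norm (F \<tau> s) \<partial>lebesgue) = (Beta \<beta> \<gamma> * indicator {a<..<t} \<tau>) * norm (w \<tau>)" for \<tau>
    using k_inner[of \<tau>] k_zero[of \<tau>] k_nonneg[of \<tau>]
    by (cases "a < \<tau> \<and> \<tau> < t") (auto simp: F_def)
  have ae_open: "AE \<tau> in lebesgue. indicator {a<..<t} \<tau> *\<^sub>R w \<tau> = w \<tau>"
  proof -
    have "AE \<tau> in lebesgue. \<tau> \<noteq> a \<and> \<tau> \<noteq> t"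
      by (intro AE_conjI AE_completion AE_lborel_singleton)
    then show ?thesis by eventually_elim (auto simp: w_def indicator_def)
  qed
  have F_int: "integrable (lebesgue \<Otimes>\<^sub>M lebesgue) (case_prod F)"
  proof (rule pair.Fubini_integrable[OF F_meas])
    have "integrable lebesgue (\<lambda>\<tau>. Beta \<beta> \<gamma> * norm (indicator {a<..<t} \<tau> *\<^sub>R w \<tau>))"
      using w_int by (intro integrable_mult_right integrable_norm integrable_mult_indicator) auto
    then show "integrable lebesgue (\<lambda>\<tau>. \<integral>s. norm (case_prod F (\<tau>, s)) \<partial>lebesgue)"
      by (simp add: F_inner_norm mult.assoc)
    have "integrable lebesgue (F \<tau>)" for \<tau>
      using k_inner(1)[of \<tau>] k_zero[of \<tau>] by (cases "a < \<tau> \<and> \<tau> < t") (auto simp: F_def)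
    then show "AE \<tau> in lebesgue. integrable lebesgue (\<lambda>s. case_prod F (\<tau>, s))" by simp
  qed

  define H where "H = (\<lambda>s. psi_kernel psi psi' \<beta> t s *\<^sub>R
      integral {a..s} (\<lambda>\<tau>. psi_kernel psi psi' \<gamma> s \<tau> *\<^sub>R y \<tau>))"
  define H0 where "H0 = (\<lambda>s. if s \<in> {a..t} then H s else 0)"
  define G where "G = (\<lambda>s. \<integral>\<tau>. F \<tau> s \<partial>lebesgue)"
  have G_eq: "G s = (if s \<in> {a..t} then H s else 0)"
    if s: "s \<noteq> a" "s \<noteq> t" and int: "integrable lebesgue (\<lambda>\<tau>. F \<tau> s)" for s
  proof (cases "s \<in> {a..t}")
    case True
    then have s': "a < s" "s < t" using s by auto
    let ?y = "\<lambda>\<tau>. psi_kernel psi psi' \<beta> t s *\<^sub>R (psi_kernel psi psi' \<gamma> s \<tau> *\<^sub>R y \<tau>)"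
    have F_eq: "(\<lambda>\<tau>. F \<tau> s) = (\<lambda>\<tau>. indicator {a<..<s} \<tau> *\<^sub>R ?y \<tau>)"
    proof
      fix \<tau>
      show "F \<tau> s = indicator {a<..<s} \<tau> *\<^sub>R ?y \<tau>"
      proof (cases "a < \<tau> \<and> \<tau> < s")
        case True
        then have "psi t - psi \<tau> > 0" using psi_less[of \<tau> t] s' by simp
        then show ?thesis using True s'
          by (simp add: F_def k_def w_def P_eq psi_kernel_def)
      next
        case False
        then show ?thesis by (auto simp: F_def k_def indicator_def)
      qed
    qed
    have "set_integrable lebesgue {a<..<s} ?y"
      using int by (simp add: F_eq set_integrable_def)
    from set_lebesgue_integral_eq_integral(2)[OF this]
    have "G s = integral {a<..<s} ?y"
      by (simp add: G_def F_eq set_lebesgue_integral_def)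
    also have "\<dots> = integral {a..s} ?y" by (rule integral_open_interval_real[symmetric])
    also have "\<dots> = H s" unfolding H_def by (rule integral_cmul)
    finally show ?thesis using True by simp
  next
    case False
    then have "(\<lambda>\<tau>. F \<tau> s) = (\<lambda>\<tau>. 0)" by (auto simp: F_def k_def)
    then show ?thesis using False by (auto simp: G_def)
  qed
  have "AE s in lebesgue. s \<noteq> a \<and> s \<noteq> t \<and> integrable lebesgue (\<lambda>\<tau>. F \<tau> s)"
  proof (intro AE_conjI)
    have "integrable (lebesgue \<Otimes>\<^sub>M lebesgue) (\<lambda>(s, \<tau>). F \<tau> s)"
      using pair.integrable_product_swap[OF F_int] by simp
    from pair.AE_integrable_fst[OF this]
    show "AE s in lebesgue. integrable lebesgue (\<lambda>\<tau>. F \<tau> s)" by simp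
  qed (intro AE_completion AE_lborel_singleton)+
  then have "AE s in lebesgue. G s = H0 s"
    by eventually_elim (auto simp: G_eq H0_def)
  \<comment> \<open>Fubini yields integrability of the inner integrand only for almost every \<open>s\<close>. Off a null set, the
    Lebesgue inner integral and the gauge integral agree; the gauge integral ignores the rest.\<close>
  then obtain N where N: "N \<in> null_sets lebesgue" "{s. G s \<noteq> H0 s} \<subseteq> N"
    unfolding eventually_ae_filter by auto
  have "integrable lebesgue G"
    unfolding G_def using pair.integrable_snd[OF F_int] .
  then have "(G has_integral integral\<^sup>L lebesgue G) UNIV"
    by (rule has_integral_integral_lebesgue)
  then have "(H0 has_integral integral\<^sup>L lebesgue G) UNIV"
  proof (rule has_integral_spike[rotated 2])
    show "negligible N" using N(1) by (simp add: negligible_iff_null_sets)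
    show "H0 s = G s" if "s \<in> UNIV - N" for s
    proof (rule ccontr)
      assume "H0 s \<noteq> G s"
      then have "s \<in> {s. G s \<noteq> H0 s}" by simp
      with N(2) that show False by blast
    qed
  qed
  then have "(H has_integral integral\<^sup>L lebesgue G) {a..t}"
    unfolding H0_def by (simp only: has_integral_restrict_UNIV)
  then have "integral {a..t} H = integral\<^sup>L lebesgue G"
    by (rule integral_unique)
  also have "\<dots> = (\<integral>\<tau>. (\<integral>s. F \<tau> s \<partial>lebesgue) \<partial>lebesgue)"
    unfolding G_def by (rule pair.Fubini_integral[OF F_int])
  also have "\<dots> = Beta \<beta> \<gamma> *\<^sub>R (\<integral>\<tau>. indicator {a<..<t} \<tau> *\<^sub>R w \<tau> \<partial>lebesgue)"
    by (simp add: F_inner flip: scaleR_scaleR)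
  also have "\<dots> = Beta \<beta> \<gamma> *\<^sub>R integral\<^sup>L lebesgue w"
    by (subst integral_cong_AE[OF _ _ ae_open])
      (auto intro!: borel_measurable_scaleR borel_measurable_indicator
          borel_measurable_integrable[OF w_int])
  finally have H_int: "integral {a..t} H
      = Beta \<beta> \<gamma> *\<^sub>R integral {a..t} (\<lambda>\<tau>. psi_kernel psi psi' (\<beta> + \<gamma>) t \<tau> *\<^sub>R y \<tau>)"
    by (simp only: w_integral)
  have "psi_integral a psi psi' \<beta> (psi_integral a psi psi' \<gamma> y) t
      = (1 / Gamma \<beta>) *\<^sub>R integral {a..t} (\<lambda>s. (1 / Gamma \<gamma>) *\<^sub>R H s)"
    using assms by (simp add: psi_integral_def H_def mult.commute)
  also have "\<dots> = (1 / (Gamma \<beta> * Gamma \<gamma>)) *\<^sub>R integral {a..t} H" by simp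
  also have "\<dots> = psi_integral a psi psi' (\<beta> + \<gamma>) y t"
    using assms(1,2) Gamma_real_pos[OF assms(1), THEN less_imp_neq]
      Gamma_real_pos[OF assms(2), THEN less_imp_neq]
    by (simp add: H_int psi_integral_def Beta_def del: Gamma_real_pos)
  finally show ?thesis .
qed

text \<open>
  Applying the fractional integral of order \<open>\<alpha>\<close> to the equation undoes the Caputo derivative: orders
  \<open>\<alpha>\<close> and \<open>1 - \<alpha>\<close> add up to the integral of order one of the \<open>\<psi>\<close>-derivative, in which \<open>\<psi>'\<close> cancels,
  so that the fundamental theorem of calculus returns \<open>x t - x a\<close>. The derivative may blow up at
  \<open>a\<close>, where \<open>x\<close> is merely continuous.
\<close>

theorem caputo_solution_integral_equation:
  fixes x :: "real \<Rightarrow> 'a::euclidean_space"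
  assumes "0 < \<alpha>" "\<alpha> \<le> 1"
    and sol: "psi_caputo_solution \<alpha> psi psi' g a b x0 x"
    and t: "t \<in> {a..b}"
  shows "x t = x0 + psi_integral a psi psi' \<alpha> (\<lambda>s. g (s, x s)) t"
proof (cases "t = a")
  case True
  then show ?thesis using sol assms(1) by (simp add: psi_caputo_solution_def psi_integral_def)
next
  case False
  with t have t: "a < t" "t \<le> b" by auto
  define y where "y = psi_deriv a b psi' x"
  let ?x' = "\<lambda>\<tau>. vector_derivative x (at \<tau> within {a..b})"
  have x: "continuous_on {a..b} x" "x a = x0"
    and x_diff: "\<And>s. s \<in> {a<..b} \<Longrightarrow> x differentiable (at s within {a..b})"
    and y_int: "psi_integrable a psi psi' (1 - \<alpha>) y t"
    and y_eq: "\<And>s. s \<in> {a<..b} \<Longrightarrow> psi_integral a psi psi' (1 - \<alpha>) y s = g (s, x s)"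
    using sol t by (auto simp: psi_caputo_solution_def psi_caputo_def y_def)
  have "(?x' has_integral (x t - x a)) {a..t}"
  proof (rule fundamental_theorem_of_calculus_interior)
    show "continuous_on {a..t} x" using x t by (auto intro: continuous_on_subset)
    fix s assume s: "s \<in> {a<..<t}"
    then have "at s within {a..b} = at s" using t by (intro at_within_interior) auto
    moreover have "(x has_vector_derivative ?x' s) (at s within {a..b})"
      using x_diff[of s] s t by (simp add: vector_derivative_works)
    ultimately show "(x has_vector_derivative ?x' s) (at s)" by simp
  qed (use t in auto)
  then have "((\<lambda>\<tau>. psi_kernel psi psi' 1 t \<tau> *\<^sub>R y \<tau>) has_integral (x t - x a)) {a..t}"
  proof (rule has_integral_spike[OF negligible_sing, rotated])
    show "psi_kernel psi psi' 1 t \<tau> *\<^sub>R y \<tau> = ?x' \<tau>" if "\<tau> \<in> {a..t} - {t}" for \<tau>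
      using that psi_less[of \<tau> t] psi'_pos[of \<tau>]
      by (auto simp: psi_kernel_def y_def psi_deriv_def)
  qed
  then have first_order: "psi_integral a psi psi' 1 y t = x t - x0"
    using x(2) by (simp add: psi_integral_def integral_unique)
  have "psi_integral a psi psi' \<alpha> (\<lambda>s. g (s, x s)) t
          = psi_integral a psi psi' \<alpha> (psi_integral a psi psi' (1 - \<alpha>) y) t"
  proof -
    have "integral {a..t} (\<lambda>\<tau>. psi_kernel psi psi' \<alpha> t \<tau> *\<^sub>R g (\<tau>, x \<tau>)) =
          integral {a..t} (\<lambda>\<tau>. psi_kernel psi psi' \<alpha> t \<tau> *\<^sub>R psi_integral a psi psi' (1 - \<alpha>) y \<tau>)"
      using t by (intro integral_spike[of "{a}"]) (auto simp: y_eq)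
    then show ?thesis using assms(1) by (simp add: psi_integral_def)
  qed
  also have "\<dots> = psi_integral a psi psi' 1 y t"
  proof (cases "\<alpha> = 1")
    case True
    have "psi_integral a psi psi' 0 y = y" by (simp add: psi_integral_def fun_eq_iff)
    with True show ?thesis by simp
  next
    case False
    with assms have \<alpha>: "0 < \<alpha>" "0 < 1 - \<alpha>" by auto
    have bil: "bilinear (\<lambda>(r::real) (u::'a). r *\<^sub>R u)"
      by (auto simp: bilinear_def intro!: linearI simp: algebra_simps)
    \<comment> \<open>Integrability at order one is inherited from order \<open>1 - \<alpha>\<close>: the two kernels differ by a
      bounded continuous factor.\<close>
    have cont: "continuous_on {a..t} (\<lambda>\<tau>. (psi t - psi \<tau>) powr \<alpha>)"
      using \<alpha> by (intro continuous_intros continuous_on_powr' psi_cont_Icc ballI)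
        (auto intro!: psi_le)
    have "(\<lambda>\<tau>. psi_kernel psi psi' (1 - \<alpha>) t \<tau> *\<^sub>R y \<tau>) absolutely_integrable_on {a..t}"
      using y_int \<alpha> by (simp add: psi_integrable_def)
    from absolutely_integrable_bounded_measurable_product[OF bil
        continuous_imp_measurable_on_sets_lebesgue[OF cont] _
        compact_imp_bounded[OF compact_continuous_image[OF cont]] this]
    have "(\<lambda>\<tau>. (psi t - psi \<tau>) powr \<alpha> *\<^sub>R (psi_kernel psi psi' (1 - \<alpha>) t \<tau> *\<^sub>R y \<tau>))
        absolutely_integrable_on {a..t}"
      by simp
    moreover have "(psi t - psi \<tau>) powr \<alpha> *\<^sub>R (psi_kernel psi psi' (1 - \<alpha>) t \<tau> *\<^sub>R y \<tau>)
        = psi_kernel psi psi' (\<alpha> + (1 - \<alpha>)) t \<tau> *\<^sub>R y \<tau>" for \<tau>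
      by (simp add: psi_kernel_def flip: powr_add mult.assoc)
    ultimately have "(\<lambda>\<tau>. psi_kernel psi psi' (\<alpha> + (1 - \<alpha>)) t \<tau> *\<^sub>R y \<tau>)
        absolutely_integrable_on {a..t}"
      by (simp only:)
    from psi_integral_compose[OF \<alpha> this] show ?thesis by simp
  qed
  finally show ?thesis using first_order by simp
qed

end

section \<open>Piecewise linear interpolation\<close>

lemma norm_diff_le_of_vector_derivative_bound:
  fixes f :: "real \<Rightarrow> 'a::real_normed_vector"
  assumes "convex S" and "\<And>u. u \<in> S \<Longrightarrow> (f has_vector_derivative f' u) (at u within S)"
    and "\<And>u. u \<in> S \<Longrightarrow> norm (f' u) \<le> B" "r \<in> S" "s \<in> S"
  shows "norm (f r - f s) \<le> B * \<bar>r - s\<bar>"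
  using differentiable_bound[of S f "\<lambda>u h. h *\<^sub>R f' u" B r s] assms
  by (simp add: has_vector_derivative_def onorm_scaleR_left onorm_id)

lemma first_order_remainder_bound:
  fixes z :: "real \<Rightarrow> 'a::real_normed_vector"
  assumes z': "\<And>u. u \<in> {p..q} \<Longrightarrow> (z has_vector_derivative z' u) (at u within {p..q})"
    and lip: "\<And>u v. u \<in> {p..q} \<Longrightarrow> v \<in> {p..q} \<Longrightarrow> norm (z' u - z' v) \<le> M * \<bar>u - v\<bar>"
    and "0 \<le> M" "\<tau> \<in> {p..q}" "s \<in> {p..q}"
  shows "norm (z s - z \<tau> - (s - \<tau>) *\<^sub>R z' \<tau>) \<le> M * (q - p)\<^sup>2"
proof -
  let ?r = "\<lambda>u. z u - (u - \<tau>) *\<^sub>R z' \<tau>"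
  have "norm (?r s - ?r \<tau>) \<le> (M * (q - p)) * \<bar>s - \<tau>\<bar>"
  proof (rule norm_diff_le_of_vector_derivative_bound[where S = "{p..q}"])
    fix u assume u: "u \<in> {p..q}"
    show "(?r has_vector_derivative (z' u - z' \<tau>)) (at u within {p..q})"
      by (auto intro!: derivative_eq_intros z' u)
    have "norm (z' u - z' \<tau>) \<le> M * \<bar>u - \<tau>\<bar>" using lip u assms by blast
    also have "\<dots> \<le> M * (q - p)" using u assms by (intro mult_left_mono) auto
    finally show "norm (z' u - z' \<tau>) \<le> M * (q - p)" .
  qed (use assms in auto)
  also have "\<dots> \<le> (M * (q - p)) * (q - p)" using assms by (intro mult_left_mono) auto
  finally show ?thesis by (simp add: power2_eq_square algebra_simps)
qed

text \<open>
  Expanding both end values about \<open>\<tau>\<close>, the first-order terms cancel because linear functions are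
  interpolated exactly; what remains is a convex combination of two second-order remainders. This
  argument works for vector values, where mean value theorems with an intermediate point fail.
\<close>

lemma linear_interpolation_error:
  fixes z :: "real \<Rightarrow> 'a::real_normed_vector"
  assumes "\<And>u. u \<in> {p..q} \<Longrightarrow> (z has_vector_derivative z' u) (at u within {p..q})"
    and "\<And>u v. u \<in> {p..q} \<Longrightarrow> v \<in> {p..q} \<Longrightarrow> norm (z' u - z' v) \<le> M * \<bar>u - v\<bar>"
    and "0 \<le> M" and \<tau>: "\<tau> \<in> {p..q}" and "p < q"
  shows "norm (z \<tau> - (((q - \<tau>) / (q - p)) *\<^sub>R z p + ((\<tau> - p) / (q - p)) *\<^sub>R z q)) \<le> M * (q - p)\<^sup>2"
proof -
  define c where "c = (\<tau> - p) / (q - p)"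
  have c: "0 \<le> c" "c \<le> 1" using \<tau> \<open>p < q\<close> by (auto simp: c_def)
  have c': "(q - \<tau>) / (q - p) = 1 - c" using \<open>p < q\<close> by (simp add: c_def field_simps)
  let ?R = "\<lambda>s. z s - z \<tau> - (s - \<tau>) *\<^sub>R z' \<tau>"
  have R: "norm (?R s) \<le> M * (q - p)\<^sup>2" if "s \<in> {p..q}" for s
    using that assms by (intro first_order_remainder_bound[of p q z]) auto
  have "(1 - c) * (p - \<tau>) + c * (q - \<tau>) = 0"
    using \<open>p < q\<close> by (simp add: c_def field_simps)
  then have "((1 - c) * (p - \<tau>) + c * (q - \<tau>)) *\<^sub>R z' \<tau> = 0" by simp
  then have "z \<tau> - ((1 - c) *\<^sub>R z p + c *\<^sub>R z q) = - ((1 - c) *\<^sub>R ?R p + c *\<^sub>R ?R q)"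
    by (simp add: algebra_simps)
  also have "norm \<dots> \<le> (1 - c) * norm (?R p) + c * norm (?R q)"
    using c norm_triangle_ineq[of "(1 - c) *\<^sub>R ?R p" "c *\<^sub>R ?R q"]
    by (simp only: norm_minus_cancel norm_scaleR abs_of_nonneg diff_ge_0_iff_ge)
  also have "\<dots> \<le> (1 - c) * (M * (q - p)\<^sup>2) + c * (M * (q - p)\<^sup>2)"
    using c \<open>p < q\<close> by (intro add_mono mult_left_mono R) auto
  finally show ?thesis unfolding c' c_def[symmetric] by (simp add: algebra_simps)
qed

lemma grid_cell_exists:
  fixes t :: "nat \<Rightarrow> real"
  assumes "t 0 < \<tau>" "\<tau> \<le> t n"
  shows "\<exists>j<n. t j < \<tau> \<and> \<tau> \<le> t (Suc j)"
  using assms(2)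
proof (induction n)
  case 0
  then show ?case using assms(1) by simp
next
  case (Suc n)
  then show ?case by (cases "\<tau> \<le> t n") (auto intro: less_SucI)
qed

lemma grid_cell_unique:
  fixes t :: "nat \<Rightarrow> real"
  assumes "strict_mono t" "t i < \<tau>" "\<tau> \<le> t (Suc i)" "t j < \<tau>" "\<tau> \<le> t (Suc j)"
  shows "i = j"
proof -
  have "t i < t (Suc j)" "t j < t (Suc i)" using assms by linarith+
  then have "i < Suc j" "j < Suc i" using \<open>strict_mono t\<close> by (simp_all add: strict_mono_less)
  then show ?thesis by simp
qed

text \<open>
  On a half-open cell only the two hats of its end points are alive. The left end of the grid
  belongs to no cell and all hats vanish there, which is why estimates below are required on
  half-open intervals only.
\<close>

lemma hat_on_cell:
  assumes t: "strict_mono t" and j: "j < n" "t j < \<tau>" "\<tau> \<le> t (Suc j)"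
  shows "hat t i n \<tau> = (if i = j then (t (Suc j) - \<tau>) / (t (Suc j) - t j)
      else if i = Suc j then (\<tau> - t j) / (t (Suc j) - t j) else 0)"
proof -
  have left: "1 \<le> i \<and> t (i - 1) < \<tau> \<and> \<tau> \<le> t i \<longleftrightarrow> i = Suc j"
    using grid_cell_unique[OF t, of "i - 1" \<tau> j] j by (cases i) auto
  have right: "i < n \<and> t i < \<tau> \<and> \<tau> \<le> t (i + 1) \<longleftrightarrow> i = j"
    using grid_cell_unique[OF t, of i \<tau> j] j by auto
  show ?thesis unfolding hat_def left right by auto
qed

lemma hat_bounds:
  assumes "strict_mono t"
  shows "0 \<le> hat t i n \<tau>" "hat t i n \<tau> \<le> 1"
proof -
  have less: "t i < t (Suc i)" "1 \<le> i \<Longrightarrow> t (i - 1) < t i"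
    using assms by (auto simp: strict_mono_less)
  show "0 \<le> hat t i n \<tau>" "hat t i n \<tau> \<le> 1"
    using less by (auto simp: hat_def divide_simps)
qed

lemma sum_hat_on_cell:
  fixes v :: "nat \<Rightarrow> 'a::real_vector"
  assumes "strict_mono t" "j < n" "t j < \<tau>" "\<tau> \<le> t (Suc j)"
  shows "(\<Sum>i\<le>n. hat t i n \<tau> *\<^sub>R v i) =
    ((t (Suc j) - \<tau>) / (t (Suc j) - t j)) *\<^sub>R v j + ((\<tau> - t j) / (t (Suc j) - t j)) *\<^sub>R v (Suc j)"
proof -
  have "(\<Sum>i\<le>n. hat t i n \<tau> *\<^sub>R v i) = (\<Sum>i\<in>{j, Suc j}. hat t i n \<tau> *\<^sub>R v i)"
    using assms by (intro sum.mono_neutral_right) (auto simp: hat_on_cell)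
  then show ?thesis using assms by (simp add: hat_on_cell)
qed

lemma hat_borel_measurable: "hat t i n \<in> borel_measurable (lebesgue_on S)"
proof -
  have "hat t i n \<in> borel_measurable borel" unfolding hat_def[abs_def] by measurable
  then show ?thesis by (intro measurable_restrict_space1 measurable_completion) simp
qed

section \<open>Quadrature errors of predictor and corrector\<close>

context time_change
begin

lemma norm_kernel_integral_le:
  fixes f :: "real \<Rightarrow> 'a::euclidean_space"
  assumes "0 < \<gamma>" "a \<le> c" "c \<le> d" "d \<le> t"
    and int: "(\<lambda>\<tau>. psi_kernel psi psi' \<gamma> t \<tau> *\<^sub>R f \<tau>) integrable_on {c..d}"
    and bound: "\<And>\<tau>. c < \<tau> \<Longrightarrow> \<tau> \<le> d \<Longrightarrow> norm (f \<tau>) \<le> B"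
  shows "norm (integral {c..d} (\<lambda>\<tau>. psi_kernel psi psi' \<gamma> t \<tau> *\<^sub>R f \<tau>))
           \<le> B * integral {c..d} (psi_kernel psi psi' \<gamma> t)"
proof -
  let ?K = "psi_kernel psi psi' \<gamma> t"
  have "norm (integral {c<..<d} (\<lambda>\<tau>. ?K \<tau> *\<^sub>R f \<tau>)) \<le> integral {c<..<d} (\<lambda>\<tau>. B * ?K \<tau>)"
  proof (rule integral_norm_bound_integral)
    show "(\<lambda>\<tau>. ?K \<tau> *\<^sub>R f \<tau>) integrable_on {c<..<d}"
      using int by (simp add: integrable_on_open_interval_real)
    have "?K integrable_on {c..d}"
      using kernel_has_integral assms(1-4) by blast
    then show "(\<lambda>\<tau>. B * ?K \<tau>) integrable_on {c<..<d}"
      by (simp add: integrable_on_open_interval_real integrable_on_mult_right)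
    show "norm (?K \<tau> *\<^sub>R f \<tau>) \<le> B * ?K \<tau>" if "\<tau> \<in> {c<..<d}" for \<tau>
      using that assms(2) kernel_nonneg[of \<tau>] bound[of \<tau>]
      by (auto simp: mult.commute[of "psi_kernel psi psi' \<gamma> t \<tau>"] intro!: mult_right_mono)
  qed
  then show ?thesis by (simp flip: integral_open_interval_real)
qed

context
  fixes \<alpha> :: real and t :: "nat \<Rightarrow> real" and n :: nat
  assumes \<alpha>: "0 < \<alpha>" and t: "strict_mono t" and t0: "a \<le> t 0"
begin

lemma grid_ge: "a \<le> t i"
  using t0 t strict_mono_less_eq[of t 0 i] by simp

lemma grid_le: "i \<le> j \<Longrightarrow> t i \<le> t j"
  using t by (simp add: strict_mono_less_eq)

lemma kernel_hat_abs_integrable: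
  assumes "i \<le> j" "j \<le> n"
  shows "(\<lambda>\<tau>. psi_kernel psi psi' \<alpha> (t n) \<tau> * hat t k n \<tau>) absolutely_integrable_on {t i..t j}"
proof -
  have "bounded (hat t k n ` {t i..t j})"
    using hat_bounds[OF t, of k n] by (intro boundedI[of _ 1]) auto
  then show ?thesis
    using kernel_mult_abs_integrable[of \<alpha> "t i" "t j" "t n" "hat t k n"] \<alpha> grid_ge grid_le assms
    by (simp add: hat_borel_measurable)
qed

lemma corrector_weight_nonneg: "0 \<le> corrector_weight \<alpha> psi psi' t i n"
  unfolding corrector_weight_def
proof (rule integral_nonneg)
  show "(\<lambda>\<tau>. psi_kernel psi psi' \<alpha> (t n) \<tau> * hat t i n \<tau>) integrable_on {t 0..t n}"
    using kernel_hat_abs_integrable[of 0 n i] by (simp add: absolutely_integrable_on_def)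
  show "0 \<le> psi_kernel psi psi' \<alpha> (t n) \<tau> * hat t i n \<tau>" if "\<tau> \<in> {t 0..t n}" for \<tau>
    using that t0 hat_bounds[OF t] by (intro mult_nonneg_nonneg kernel_nonneg) auto
qed

text \<open>
  The corrector rule is the exact integral of the kernel against the piecewise linear interpolant.
\<close>

lemma corrector_sum_has_integral:
  fixes v :: "nat \<Rightarrow> 'a::euclidean_space"
  shows "((\<lambda>\<tau>. psi_kernel psi psi' \<alpha> (t n) \<tau> *\<^sub>R (\<Sum>i\<le>n. hat t i n \<tau> *\<^sub>R v i))
           has_integral (\<Sum>i\<le>n. corrector_weight \<alpha> psi psi' t i n *\<^sub>R v i)) {t 0..t n}"
proof -
  have "((\<lambda>\<tau>. (psi_kernel psi psi' \<alpha> (t n) \<tau> * hat t i n \<tau>) *\<^sub>R v i)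
           has_integral corrector_weight \<alpha> psi psi' t i n *\<^sub>R v i) {t 0..t n}" for i
    unfolding corrector_weight_def using kernel_hat_abs_integrable[of 0 n i]
    by (intro has_integral_scaleR_left integrable_integral)
      (auto simp: absolutely_integrable_on_def)
  then have "((\<lambda>\<tau>. \<Sum>i\<le>n. (psi_kernel psi psi' \<alpha> (t n) \<tau> * hat t i n \<tau>) *\<^sub>R v i)
           has_integral (\<Sum>i\<le>n. corrector_weight \<alpha> psi psi' t i n *\<^sub>R v i)) {t 0..t n}"
    by (intro has_integral_sum) auto
  then show ?thesis by (simp add: scaleR_sum_right)
qed

lemma corrector_weight_sum_le:
  "(\<Sum>i\<le>n. corrector_weight \<alpha> psi psi' t i n) \<le> (psi (t n) - psi (t 0)) powr \<alpha> / \<alpha>"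
proof -
  let ?f = "\<lambda>\<tau>. \<Sum>i\<le>n. hat t i n \<tau> *\<^sub>R (1::real)"
  have int: "((\<lambda>\<tau>. psi_kernel psi psi' \<alpha> (t n) \<tau> *\<^sub>R ?f \<tau>)
               has_integral (\<Sum>i\<le>n. corrector_weight \<alpha> psi psi' t i n)) {t 0..t n}"
    using corrector_sum_has_integral[of "\<lambda>i. 1::real"] by simp
  have "norm (integral {t 0..t n} (\<lambda>\<tau>. psi_kernel psi psi' \<alpha> (t n) \<tau> *\<^sub>R ?f \<tau>))
      \<le> 1 * integral {t 0..t n} (psi_kernel psi psi' \<alpha> (t n))"
  proof (rule norm_kernel_integral_le)
    fix \<tau> assume "t 0 < \<tau>" "\<tau> \<le> t n"
    then obtain j where j: "j < n" "t j < \<tau>" "\<tau> \<le> t (Suc j)" using grid_cell_exists[of t \<tau> n] by auto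
    then have "?f \<tau> = 1"
      unfolding sum_hat_on_cell[OF t j] by (simp add: divide_simps)
    then show "norm (?f \<tau>) \<le> 1" by simp
  qed (use \<alpha> t0 grid_le int in \<open>auto intro: has_integral_integrable\<close>)
  moreover have "integral {t 0..t n} (psi_kernel psi psi' \<alpha> (t n))
      = (psi (t n) - psi (t 0)) powr \<alpha> / \<alpha>"
    using kernel_has_integral[of \<alpha> "t 0" "t n" "t n"] \<alpha> t0 grid_le by (simp add: integral_unique)
  ultimately show ?thesis using int by (simp add: integral_unique)
qed

text \<open>
  The last hat lives on the last cell only. The resulting bound is of order \<open>h powr \<alpha>\<close>; this factor
  raises the first-order accuracy of the predictor to the order \<open>1 + \<alpha>\<close> of the scheme.
\<close>

lemma corrector_diagonal_weight_le:
  assumes "1 \<le> n"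
  shows "corrector_weight \<alpha> psi psi' t n n \<le> (psi (t n) - psi (t (n - 1))) powr \<alpha> / \<alpha>"
proof -
  let ?K = "psi_kernel psi psi' \<alpha> (t n)"
  let ?f = "\<lambda>\<tau>. ?K \<tau> * hat t n n \<tau>"
  have int: "?f integrable_on {t i..t j}" if "i \<le> j" "j \<le> n" for i j
    using kernel_hat_abs_integrable[OF that] by (simp add: absolutely_integrable_on_def)
  have "norm (integral {t 0..t (n - 1)} (\<lambda>\<tau>. ?K \<tau> *\<^sub>R hat t n n \<tau>))
      \<le> 0 * integral {t 0..t (n - 1)} ?K"
  proof (rule norm_kernel_integral_le)
    fix \<tau> assume "t 0 < \<tau>" "\<tau> \<le> t (n - 1)"
    then show "norm (hat t n n \<tau>) \<le> 0" by (simp add: hat_def)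
  qed (use \<alpha> t0 grid_le int in auto)
  then have outside: "integral {t 0..t (n - 1)} ?f = 0" by simp
  have "norm (integral {t (n - 1)..t n} (\<lambda>\<tau>. ?K \<tau> *\<^sub>R hat t n n \<tau>))
      \<le> 1 * integral {t (n - 1)..t n} ?K"
    using \<alpha> grid_ge grid_le int[of "n - 1" n] hat_bounds[OF t, of n n]
    by (intro norm_kernel_integral_le) auto
  then have inside: "integral {t (n - 1)..t n} ?f \<le> integral {t (n - 1)..t n} ?K"
    by simp
  have "corrector_weight \<alpha> psi psi' t n n = integral {t 0..t (n - 1)} ?f + integral {t (n - 1)..t n} ?f"
    unfolding corrector_weight_def
    using int[of 0 n] grid_le by (intro Henstock_Kurzweil_Integration.integral_combine[symmetric]) auto
  also have "\<dots> \<le> integral {t (n - 1)..t n} ?K"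
    using outside inside by linarith
  also have "\<dots> = (psi (t n) - psi (t (n - 1))) powr \<alpha> / \<alpha>"
    using kernel_has_integral[of \<alpha> "t (n - 1)" "t n" "t n"] \<alpha> grid_ge grid_le
    by (simp add: integral_unique)
  finally show ?thesis .
qed

lemma corrector_quadrature_error:
  fixes z :: "real \<Rightarrow> 'a::euclidean_space"
  assumes z: "continuous_on {t 0..t n} z"
    and interp: "\<And>j \<tau>. j < n \<Longrightarrow> t j < \<tau> \<Longrightarrow> \<tau> \<le> t (Suc j) \<Longrightarrow>
      norm (z \<tau> - (((t (Suc j) - \<tau>) / (t (Suc j) - t j)) *\<^sub>R z (t j)
                   + ((\<tau> - t j) / (t (Suc j) - t j)) *\<^sub>R z (t (Suc j)))) \<le> B"
  shows "norm (integral {t 0..t n} (\<lambda>\<tau>. psi_kernel psi psi' \<alpha> (t n) \<tau> *\<^sub>R z \<tau>)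
            - (\<Sum>i\<le>n. corrector_weight \<alpha> psi psi' t i n *\<^sub>R z (t i)))
         \<le> B * ((psi (t n) - psi (t 0)) powr \<alpha> / \<alpha>)"
proof -
  let ?K = "psi_kernel psi psi' \<alpha> (t n)"
  let ?p = "\<lambda>\<tau>. \<Sum>i\<le>n. hat t i n \<tau> *\<^sub>R z (t i)"
  have "(\<lambda>\<tau>. ?K \<tau> *\<^sub>R z \<tau>) integrable_on {t 0..t n}"
    using kernel_mult_continuous_abs_integrable[OF \<alpha> t0 order_refl z]
    by (simp add: absolutely_integrable_on_def)
  then have "((\<lambda>\<tau>. ?K \<tau> *\<^sub>R (z \<tau> - ?p \<tau>)) has_integral
      (integral {t 0..t n} (\<lambda>\<tau>. ?K \<tau> *\<^sub>R z \<tau>)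
        - (\<Sum>i\<le>n. corrector_weight \<alpha> psi psi' t i n *\<^sub>R z (t i)))) {t 0..t n}"
    unfolding scaleR_diff_right
    by (intro has_integral_diff integrable_integral corrector_sum_has_integral)
  moreover have "norm (integral {t 0..t n} (\<lambda>\<tau>. ?K \<tau> *\<^sub>R (z \<tau> - ?p \<tau>)))
      \<le> B * integral {t 0..t n} ?K"
  proof (rule norm_kernel_integral_le)
    fix \<tau> assume "t 0 < \<tau>" "\<tau> \<le> t n"
    then obtain j where j: "j < n" "t j < \<tau>" "\<tau> \<le> t (Suc j)" using grid_cell_exists[of t \<tau> n] by auto
    then show "norm (z \<tau> - ?p \<tau>) \<le> B"
      unfolding sum_hat_on_cell[OF t j] by (rule interp)
  qed (use \<alpha> t0 grid_le calculation in \<open>auto intro: has_integral_integrable\<close>)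
  moreover have "integral {t 0..t n} ?K = (psi (t n) - psi (t 0)) powr \<alpha> / \<alpha>"
    using kernel_has_integral[of \<alpha> "t 0" "t n" "t n"] \<alpha> t0 grid_le by (simp add: integral_unique)
  ultimately show ?thesis by (simp add: integral_unique)
qed

lemma integral_grid_split:
  fixes f :: "real \<Rightarrow> 'b::euclidean_space"
  assumes "f integrable_on {t 0..t m}"
  shows "integral {t 0..t m} f = (\<Sum>i<m. integral {t i..t (i + 1)} f)"
  using assms
proof (induction m)
  case 0
  then show ?case by simp
next
  case (Suc m)
  have "f integrable_on {t 0..t m}"
    using Suc.prems grid_le[of m "Suc m"] by (auto intro: integrable_subinterval_real)
  moreover have "integral {t 0..t m} f + integral {t m..t (Suc m)} f = integral {t 0..t (Suc m)} f"
    using Suc.prems grid_le by (intro Henstock_Kurzweil_Integration.integral_combine) auto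
  ultimately show ?case using Suc.IH by simp
qed

lemma predictor_weight_nonneg:
  assumes "i < n"
  shows "0 \<le> predictor_weight \<alpha> psi psi' t i n"
  unfolding predictor_weight_def
proof (rule integral_nonneg)
  show "psi_kernel psi psi' \<alpha> (t n) integrable_on {t i..t (i + 1)}"
    using kernel_has_integral[of \<alpha> "t i" "t (i + 1)" "t n"] \<alpha> grid_ge grid_le assms by auto
  show "0 \<le> psi_kernel psi psi' \<alpha> (t n) \<tau>" if "\<tau> \<in> {t i..t (i + 1)}" for \<tau>
    using that grid_ge[of i] by (intro kernel_nonneg) auto
qed

lemma predictor_weight_sum:
  "(\<Sum>i<n. predictor_weight \<alpha> psi psi' t i n) = (psi (t n) - psi (t 0)) powr \<alpha> / \<alpha>"
proof -
  have "(psi_kernel psi psi' \<alpha> (t n) has_integral (psi (t n) - psi (t 0)) powr \<alpha> / \<alpha>) {t 0..t n}"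
    using kernel_has_integral[of \<alpha> "t 0" "t n" "t n"] \<alpha> t0 grid_le by simp
  then show ?thesis
    using integral_grid_split[of "psi_kernel psi psi' \<alpha> (t n)" n]
    by (auto simp: predictor_weight_def integral_unique)
qed

lemma predictor_quadrature_error:
  fixes z :: "real \<Rightarrow> 'a::euclidean_space"
  assumes z: "continuous_on {t 0..t n} z"
    and step: "\<And>j \<tau>. j < n \<Longrightarrow> t j < \<tau> \<Longrightarrow> \<tau> \<le> t (Suc j) \<Longrightarrow> norm (z \<tau> - z (t j)) \<le> B"
  shows "norm (integral {t 0..t n} (\<lambda>\<tau>. psi_kernel psi psi' \<alpha> (t n) \<tau> *\<^sub>R z \<tau>)
            - (\<Sum>i<n. predictor_weight \<alpha> psi psi' t i n *\<^sub>R z (t i)))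
         \<le> B * ((psi (t n) - psi (t 0)) powr \<alpha> / \<alpha>)"
proof -
  let ?K = "psi_kernel psi psi' \<alpha> (t n)"
  have int: "(\<lambda>\<tau>. ?K \<tau> *\<^sub>R z \<tau>) integrable_on {t 0..t n}"
    using kernel_mult_continuous_abs_integrable[OF \<alpha> t0 order_refl z]
    by (simp add: absolutely_integrable_on_def)
  have cell: "norm (integral {t i..t (i + 1)} (\<lambda>\<tau>. ?K \<tau> *\<^sub>R z \<tau>)
                - predictor_weight \<alpha> psi psi' t i n *\<^sub>R z (t i))
              \<le> B * predictor_weight \<alpha> psi psi' t i n" if i: "i < n" for i
  proof -
    have "?K integrable_on {t i..t (i + 1)}"
      using kernel_has_integral[of \<alpha> "t i" "t (i + 1)" "t n"] \<alpha> grid_ge grid_le i by auto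
    moreover have "(\<lambda>\<tau>. ?K \<tau> *\<^sub>R z \<tau>) integrable_on {t i..t (i + 1)}"
      using int by (rule integrable_subinterval_real) (use i grid_le in auto)
    ultimately have "((\<lambda>\<tau>. ?K \<tau> *\<^sub>R (z \<tau> - z (t i))) has_integral
        (integral {t i..t (i + 1)} (\<lambda>\<tau>. ?K \<tau> *\<^sub>R z \<tau>)
          - predictor_weight \<alpha> psi psi' t i n *\<^sub>R z (t i))) {t i..t (i + 1)}"
      unfolding scaleR_diff_right predictor_weight_def
      by (intro has_integral_diff has_integral_scaleR_left integrable_integral)
    moreover from this have "norm (integral {t i..t (i + 1)} (\<lambda>\<tau>. ?K \<tau> *\<^sub>R (z \<tau> - z (t i))))
        \<le> B * integral {t i..t (i + 1)} ?K"
      using \<alpha> grid_ge grid_le i step[of i]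
      by (intro norm_kernel_integral_le) (auto intro: has_integral_integrable)
    ultimately show ?thesis by (simp add: integral_unique predictor_weight_def)
  qed
  let ?d = "\<lambda>i. integral {t i..t (i + 1)} (\<lambda>\<tau>. ?K \<tau> *\<^sub>R z \<tau>)
                - predictor_weight \<alpha> psi psi' t i n *\<^sub>R z (t i)"
  have "norm (\<Sum>i<n. ?d i) \<le> (\<Sum>i<n. B * predictor_weight \<alpha> psi psi' t i n)"
    using cell by (intro sum_norm_le) auto
  moreover have "(\<Sum>i<n. B * predictor_weight \<alpha> psi psi' t i n)
      = B * ((psi (t n) - psi (t 0)) powr \<alpha> / \<alpha>)"
    by (simp only: predictor_weight_sum flip: sum_distrib_left)
  moreover have "integral {t 0..t n} (\<lambda>\<tau>. ?K \<tau> *\<^sub>R z \<tau>)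
      - (\<Sum>i<n. predictor_weight \<alpha> psi psi' t i n *\<^sub>R z (t i)) = (\<Sum>i<n. ?d i)"
    by (simp only: integral_grid_split[OF int] sum_subtractf)
  ultimately show ?thesis by (simp only:)
qed

lemma abm_Suc_eq:
  fixes g :: "real \<times> 'a::euclidean_space \<Rightarrow> 'a" and x0 :: 'a and k :: nat
  defines "y \<equiv> \<lambda>i. g (t i, abm \<alpha> psi psi' g t x0 i)"
  defines "xP \<equiv> x0 + (1 / Gamma \<alpha>) *\<^sub>R (\<Sum>i<Suc k. predictor_weight \<alpha> psi psi' t i (Suc k) *\<^sub>R y i)"
  shows "abm \<alpha> psi psi' g t x0 (Suc k) = x0 + (1 / Gamma \<alpha>) *\<^sub>R
      ((\<Sum>i<Suc k. corrector_weight \<alpha> psi psi' t i (Suc k) *\<^sub>R y i)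
        + corrector_weight \<alpha> psi psi' t (Suc k) (Suc k) *\<^sub>R g (t (Suc k), xP))"
  by (simp only: xP_def y_def abm.simps Let_def lessThan_Suc_atMost atMost_atLeast0
      Suc_eq_plus1[symmetric])

text \<open>
  The error recursion. The exact value and the numerical one use the same quadrature weights, so
  their difference splits into the quadrature error and the weighted errors of the earlier values.
  The weights sum to at most \<open>q\<close> (after division by \<open>\<Gamma> \<alpha>\<close>), and the error of the predictor
  enters through the diagonal weight, bounded by \<open>\<nu>\<close>.
\<close>

lemma abm_step_error:
  fixes g :: "real \<times> 'a::euclidean_space \<Rightarrow> 'a" and x :: "real \<Rightarrow> 'a" and x0 :: 'a
  defines "z \<equiv> \<lambda>s. g (s, x s)"
  defines "q \<equiv> (psi (t n) - psi (t 0)) powr \<alpha> / \<alpha> / Gamma \<alpha>"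
  defines "\<nu> \<equiv> (psi (t n) - psi (t (n - 1))) powr \<alpha> / \<alpha> / Gamma \<alpha>"
  assumes n: "1 \<le> n"
    and x: "x (t n) = x0 + psi_integral (t 0) psi psi' \<alpha> z (t n)"
    and z: "continuous_on {t 0..t n} z"
    and step: "\<And>j \<tau>. j < n \<Longrightarrow> t j < \<tau> \<Longrightarrow> \<tau> \<le> t (Suc j) \<Longrightarrow> norm (z \<tau> - z (t j)) \<le> B1"
    and interp: "\<And>j \<tau>. j < n \<Longrightarrow> t j < \<tau> \<Longrightarrow> \<tau> \<le> t (Suc j) \<Longrightarrow>
      norm (z \<tau> - (((t (Suc j) - \<tau>) / (t (Suc j) - t j)) *\<^sub>R z (t j)
                   + ((\<tau> - t j) / (t (Suc j) - t j)) *\<^sub>R z (t (Suc j)))) \<le> B2"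
    and lip: "\<And>i u. i \<le> n \<Longrightarrow> norm (z (t i) - g (t i, u)) \<le> L * norm (x (t i) - u)"
    and "0 \<le> L"
    and err: "\<And>i. i < n \<Longrightarrow> norm (x (t i) - abm \<alpha> psi psi' g t x0 i) \<le> E"
    and "0 \<le> E"
  shows "norm (x (t n) - abm \<alpha> psi psi' g t x0 n)
           \<le> B2 * q + L * E * q + \<nu> * L * (B1 * q + L * E * q)"
proof -
  define Q where "Q = (psi (t n) - psi (t 0)) powr \<alpha> / \<alpha>"
  define N where "N = (psi (t n) - psi (t (n - 1))) powr \<alpha> / \<alpha>"
  define G where "G = Gamma \<alpha>"
  define I where "I = integral {t 0..t n} (\<lambda>\<tau>. psi_kernel psi psi' \<alpha> (t n) \<tau> *\<^sub>R z \<tau>)"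
  define y where "y = (\<lambda>i. g (t i, abm \<alpha> psi psi' g t x0 i))"
  define aw where "aw = (\<lambda>i. corrector_weight \<alpha> psi psi' t i n)"
  define bw where "bw = (\<lambda>i. predictor_weight \<alpha> psi psi' t i n)"
  define xP where "xP = x0 + (1 / G) *\<^sub>R (\<Sum>i<n. bw i *\<^sub>R y i)"
  have G: "G > 0" using \<alpha> by (simp add: G_def Gamma_real_pos)
  have Q: "Q \<ge> 0" "N \<ge> 0" using \<alpha> by (simp_all add: Q_def N_def)
  have q_eq: "q = Q / G" "\<nu> = N / G" by (simp_all add: q_def \<nu>_def Q_def N_def G_def)
  have x_eq: "x (t n) = x0 + (1 / G) *\<^sub>R I"
    using x \<alpha> by (simp add: psi_integral_def I_def G_def)
  have y_err: "norm (z (t i) - y i) \<le> L * E" if "i < n" for i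
  proof -
    have "norm (z (t i) - y i) \<le> L * norm (x (t i) - abm \<alpha> psi psi' g t x0 i)"
      using lip[of i] that by (simp add: y_def)
    also have "\<dots> \<le> L * E" using err[OF that] \<open>0 \<le> L\<close> by (rule mult_left_mono)
    finally show ?thesis .
  qed
  have weighted: "norm (\<Sum>i<n. c i *\<^sub>R (z (t i) - y i)) \<le> Q * (L * E)"
    if "\<And>i. i < n \<Longrightarrow> 0 \<le> c i" "(\<Sum>i<n. c i) \<le> Q" for c
  proof -
    have "norm (\<Sum>i<n. c i *\<^sub>R (z (t i) - y i)) \<le> (\<Sum>i<n. c i * (L * E))"
      using that(1) y_err by (intro sum_norm_le) (auto intro!: mult_left_mono)
    also have "\<dots> \<le> Q * (L * E)"
      unfolding sum_distrib_right[symmetric]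
      using that(2) \<open>0 \<le> L\<close> \<open>0 \<le> E\<close> by (intro mult_right_mono) auto
    finally show ?thesis .
  qed

  have P_err: "norm (x (t n) - xP) \<le> B1 * q + L * E * q"
  proof -
    have "x (t n) - xP = (1 / G) *\<^sub>R ((I - (\<Sum>i<n. bw i *\<^sub>R z (t i))) + (\<Sum>i<n. bw i *\<^sub>R (z (t i) - y i)))"
      by (simp add: x_eq xP_def scaleR_diff_right sum_subtractf algebra_simps)
    also have "norm \<dots> \<le> (1 / G) * (B1 * Q + Q * (L * E))"
      unfolding norm_scaleR
    proof (intro mult_mono order_trans[OF norm_triangle_ineq] add_mono weighted)
      show "norm (I - (\<Sum>i<n. bw i *\<^sub>R z (t i))) \<le> B1 * Q"
        unfolding I_def bw_def Q_def by (rule predictor_quadrature_error[OF z step])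
      show "(\<Sum>i<n. bw i) \<le> Q" unfolding bw_def Q_def predictor_weight_sum ..
      show "0 \<le> bw i" if "i < n" for i unfolding bw_def by (rule predictor_weight_nonneg[OF that])
    qed (use G in auto)
    finally show ?thesis using G by (simp add: q_eq field_simps)
  qed

  have split: "(\<Sum>i\<le>n. c i) = (\<Sum>i<n. c i) + c n" for c :: "nat \<Rightarrow> 'b::comm_monoid_add"
    by (simp add: lessThan_Suc_atMost[symmetric])
  have "x (t n) - abm \<alpha> psi psi' g t x0 n = (1 / G) *\<^sub>R
      ((I - (\<Sum>i\<le>n. aw i *\<^sub>R z (t i))) + (\<Sum>i<n. aw i *\<^sub>R (z (t i) - y i))
        + aw n *\<^sub>R (z (t n) - g (t n, xP)))"
  proof -
    obtain k where k: "n = Suc k" using n by (cases n) auto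
    have "abm \<alpha> psi psi' g t x0 n = x0 + (1 / G) *\<^sub>R ((\<Sum>i<n. aw i *\<^sub>R y i) + aw n *\<^sub>R g (t n, xP))"
      unfolding k abm_Suc_eq xP_def G_def y_def aw_def bw_def ..
    then show ?thesis
      by (simp add: x_eq split scaleR_diff_right sum_subtractf algebra_simps)
  qed
  also have "norm \<dots> \<le> (1 / G) * (B2 * Q + Q * (L * E) + N * (L * (B1 * q + L * E * q)))"
    unfolding norm_scaleR
  proof (intro mult_mono order_trans[OF norm_triangle_ineq] add_mono weighted)
    show "norm (I - (\<Sum>i\<le>n. aw i *\<^sub>R z (t i))) \<le> B2 * Q"
      unfolding I_def aw_def Q_def by (rule corrector_quadrature_error[OF z interp])
    show nonneg: "0 \<le> aw i" for i unfolding aw_def by (rule corrector_weight_nonneg)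
    show "(\<Sum>i<n. aw i) \<le> Q"
      using corrector_weight_sum_le nonneg[of n] by (simp add: split aw_def Q_def)
    have "norm (z (t n) - g (t n, xP)) \<le> L * norm (x (t n) - xP)" by (rule lip) simp
    also have "\<dots> \<le> L * (B1 * q + L * E * q)" using P_err \<open>0 \<le> L\<close> by (rule mult_left_mono)
    finally have "norm (z (t n) - g (t n, xP)) \<le> L * (B1 * q + L * E * q)" .
    moreover have "aw n \<le> N" unfolding aw_def N_def by (rule corrector_diagonal_weight_le[OF n])
    ultimately have "aw n * norm (z (t n) - g (t n, xP)) \<le> N * (L * (B1 * q + L * E * q))"
      using Q by (intro mult_mono) auto
    then show "norm (aw n *\<^sub>R (z (t n) - g (t n, xP))) \<le> N * (L * (B1 * q + L * E * q))"
      using nonneg[of n] by simp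
  qed (use G in auto)
  also have "\<dots> = B2 * q + L * E * q + \<nu> * L * (B1 * q + L * E * q)"
    by (simp add: q_eq add_divide_distrib distrib_left mult_ac)
  finally show ?thesis .
qed

end

section \<open>Convergence of order \<open>1 + \<alpha>\<close>\<close>

text \<open>
  The total weight \<open>q T\<close> tends to zero as \<open>T\<close> decreases to \<open>a\<close>. Once \<open>L * q T \<le> 1/4\<close>, inserting the
  bound \<open>E\<close> for all earlier errors into the error recursion returns at most \<open>E/2\<close> plus terms of
  order \<open>h powr (1 + \<alpha>)\<close>, so a single constant survives the induction on the step number.
\<close>

theorem abm_error_bound:
  fixes g :: "real \<times> 'a::euclidean_space \<Rightarrow> 'a" and x :: "real \<Rightarrow> 'a"
  assumes \<alpha>: "0 < \<alpha>" "\<alpha> \<le> 1" and "a < b"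
    and g_lip: "L-lipschitz_on ({a..b} \<times> UNIV) g"
    and sol: "psi_caputo_solution \<alpha> psi psi' g a b x0 x"
    and C2: "C2_on {a..b} (\<lambda>t. g (t, x t))"
  shows "\<exists>T\<in>{a<..b}. \<exists>C. \<forall>h>0. \<forall>k. uniform_grid a h k \<le> T \<longrightarrow>
           norm (x (uniform_grid a h k) - abm \<alpha> psi psi' g (uniform_grid a h) x0 k)
             \<le> C * h powr (1 + \<alpha>)"
proof -
  define z where "z = (\<lambda>t. g (t, x t))"
  have L: "0 \<le> L" using g_lip by (rule lipschitz_on_nonneg)
  have G: "0 < Gamma \<alpha>" using \<alpha> by (simp add: Gamma_real_pos)
  have bounded_norm: "\<exists>M\<ge>0. \<forall>s\<in>{a..b}. norm (f s) \<le> M"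
    if "continuous_on {a..b} f" for f :: "real \<Rightarrow> 'b::real_normed_vector"
  proof -
    have "bounded (f ` {a..b})"
      using that by (intro compact_imp_bounded compact_continuous_image) auto
    then obtain M where "0 < M" "\<forall>s\<in>f ` {a..b}. norm s \<le> M" by (auto simp: bounded_pos)
    then show ?thesis by (intro exI[of _ M]) auto
  qed
  obtain z' z'' where
    z': "\<And>s. s \<in> {a..b} \<Longrightarrow> (z has_vector_derivative z' s) (at s within {a..b})" and
    z'': "\<And>s. s \<in> {a..b} \<Longrightarrow> (z' has_vector_derivative z'' s) (at s within {a..b})" and
    z''_cont: "continuous_on {a..b} z''"
    using C2 unfolding C2_on_def z_def[symmetric] by blast
  have z_cont: "continuous_on {a..b} z" and z'_cont: "continuous_on {a..b} z'"
    by (rule continuous_on_vector_derivative, erule z' z'')+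
  obtain M1 where M1: "0 \<le> M1" "\<And>s. s \<in> {a..b} \<Longrightarrow> norm (z' s) \<le> M1"
    using bounded_norm[OF z'_cont] by auto
  obtain M2 where M2: "0 \<le> M2" "\<And>s. s \<in> {a..b} \<Longrightarrow> norm (z'' s) \<le> M2"
    using bounded_norm[OF z''_cont] by auto
  obtain D where D: "0 \<le> D" "\<And>s. s \<in> {a..b} \<Longrightarrow> norm (psi' s) \<le> D"
    using bounded_norm[OF psi'_cont_Icc[of a b]] by auto
  have z_lip: "norm (z u - z v) \<le> M1 * \<bar>u - v\<bar>" if "u \<in> {a..b}" "v \<in> {a..b}" for u v
    by (rule norm_diff_le_of_vector_derivative_bound[of "{a..b}" z z']) (use z' M1 that in auto)
  have z'_lip: "norm (z' u - z' v) \<le> M2 * \<bar>u - v\<bar>" if "u \<in> {a..b}" "v \<in> {a..b}" for u v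
    by (rule norm_diff_le_of_vector_derivative_bound[of "{a..b}" z' z'']) (use z'' M2 that in auto)
  have psi_lip: "norm (psi u - psi v) \<le> D * \<bar>u - v\<bar>" if "u \<in> {a..b}" "v \<in> {a..b}" for u v
  proof (rule norm_diff_le_of_vector_derivative_bound[of "{a..b}" psi psi'])
    show "(psi has_vector_derivative psi' s) (at s within {a..b})" if "s \<in> {a..b}" for s
      unfolding has_real_derivative_iff_has_vector_derivative[symmetric]
      using that by (auto intro: DERIV_subset[OF psi_has_deriv])
  qed (use D that in auto)

  define q where "q = (\<lambda>s. (psi s - psi a) powr \<alpha> / \<alpha> / Gamma \<alpha>)"
  have q_cont: "continuous_on {a..b} q"
  proof -
    have "continuous_on {a..b} (\<lambda>s. (psi s - psi a) powr \<alpha>)"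
      using \<alpha> by (intro continuous_on_powr' continuous_intros psi_cont_Icc ballI)
        (auto intro!: psi_le)
    then show ?thesis
      unfolding q_def using \<alpha> less_imp_neq[OF G]
      by (intro continuous_on_divide continuous_on_const) auto
  qed
  have q_mono: "q r \<le> q s" if "a \<le> r" "r \<le> s" for r s
    unfolding q_def using that \<alpha> G psi_le[of a r] psi_le[of r s]
    by (intro divide_right_mono powr_mono2) auto
  have q_nonneg: "0 \<le> q s" for s using \<alpha> G by (simp add: q_def)
  have "\<exists>T\<in>{a<..b}. L * q T \<le> 1 / 4"
  proof -
    have "((\<lambda>s. L * q s) \<longlongrightarrow> L * q a) (at a within {a..b})"
      using q_cont \<open>a < b\<close> by (intro tendsto_intros) (auto simp: continuous_on_def)
    then have "\<forall>\<^sub>F s in at a within {a..b}. L * q s < 1 / 4"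
      by (rule order_tendstoD) (use \<alpha> in \<open>simp add: q_def\<close>)
    moreover have "\<forall>\<^sub>F s in at a within {a..b}. s \<in> {a<..b}"
      by (auto simp: eventually_at_filter)
    ultimately have ev: "\<forall>\<^sub>F s in at a within {a..b}. s \<in> {a<..b} \<and> L * q s \<le> 1 / 4"
      by eventually_elim auto
    have "at a within {a..b} \<noteq> bot"
      using \<open>a < b\<close> by (simp add: at_within_Icc_at_right)
    from eventually_happens'[OF this ev] show ?thesis by blast
  qed
  then obtain T where T: "a < T" "T \<le> b" "L * q T \<le> 1 / 4" by auto
  define d where "d = D powr \<alpha> / \<alpha> / Gamma \<alpha>"
  have d: "0 \<le> d" using \<alpha> G by (simp add: d_def)
  \<comment> \<open>\<open>A\<close> collects the two sources of error: interpolation, where \<open>h\<^sup>2 \<le> (T - a) powr (1 - \<alpha>) * h powr (1 + \<alpha>)\<close>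
    because \<open>h \<le> T - a\<close>, and the first-order error of the predictor times the diagonal weight.\<close>
  define A where "A = M2 * q T * (T - a) powr (1 - \<alpha>) + d * L * M1 * q T"
  have A: "0 \<le> A" using M1 M2 d L T q_nonneg by (simp add: A_def)

  have "norm (x (uniform_grid a h k) - abm \<alpha> psi psi' g (uniform_grid a h) x0 k)
          \<le> 2 * A * h powr (1 + \<alpha>)"
    if h: "0 < h" and kT: "uniform_grid a h k \<le> T" for h k
    using kT
  proof (induction k rule: less_induct)
    case (less k)
    define t where "t = uniform_grid a h"
    have t_eq: "t i = a + real i * h" for i by (simp add: t_def uniform_grid_def)
    have t_mono: "strict_mono t" using h by (simp add: strict_mono_def t_eq)
    show ?case
    proof (cases "k = 0")
      case True
      then show ?thesis using sol A by (simp add: uniform_grid_def psi_caputo_solution_def)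
    next
      case False
      then have k: "1 \<le> k" by simp
      have t_le: "t i \<le> T" if "i \<le> k" for i
        using that less.prems t_mono by (metis order_trans strict_mono_less_eq t_def)
      have t_in: "t i \<in> {a..b}" if "i \<le> k" for i
        using t_le[OF that] T h by (simp add: t_eq)
      have hT: "h \<le> T - a" using t_le[of 1] k by (simp add: t_eq)
      define E where "E = 2 * A * h powr (1 + \<alpha>)"
      have E: "0 \<le> E" using A by (simp add: E_def)
      define \<nu> where "\<nu> = (psi (t k) - psi (t (k - 1))) powr \<alpha> / \<alpha> / Gamma \<alpha>"
      have "norm (x (t k) - abm \<alpha> psi psi' g t x0 k)
          \<le> (M2 * h\<^sup>2) * q (t k) + L * E * q (t k)
             + \<nu> * L * ((M1 * h) * q (t k) + L * E * q (t k))"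
      proof -
        have t0: "t 0 = a" by (simp add: t_eq)
        show ?thesis
          unfolding q_def \<nu>_def t0[symmetric]
        proof (rule abm_step_error[OF \<alpha>(1) t_mono _ k])
          show "x (t k) = x0 + psi_integral (t 0) psi psi' \<alpha> (\<lambda>s. g (s, x s)) (t k)"
            unfolding t0 by (rule caputo_solution_integral_equation[OF \<alpha> sol t_in]) simp
          show "continuous_on {t 0..t k} (\<lambda>s. g (s, x s))"
            using z_cont t_in[of k] t0 unfolding z_def by (auto intro: continuous_on_subset)
          fix j \<tau> assume j: "j < k" "t j < \<tau>" "\<tau> \<le> t (Suc j)"
          have cell: "{t j..t (Suc j)} \<subseteq> {a..b}" using t_in[of j] t_in[of "Suc j"] j by auto
          have width: "t (Suc j) - t j = h" by (simp add: t_eq algebra_simps)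
          have "norm (z \<tau> - z (t j)) \<le> M1 * \<bar>\<tau> - t j\<bar>" using cell j by (intro z_lip) auto
          also have "\<dots> \<le> M1 * h" using j width M1 by (intro mult_left_mono) auto
          finally show "norm (g (\<tau>, x \<tau>) - g (t j, x (t j))) \<le> M1 * h" by (simp add: z_def)
          have "norm (z \<tau> - (((t (Suc j) - \<tau>) / (t (Suc j) - t j)) *\<^sub>R z (t j)
                   + ((\<tau> - t j) / (t (Suc j) - t j)) *\<^sub>R z (t (Suc j)))) \<le> M2 * (t (Suc j) - t j)\<^sup>2"
          proof (rule linear_interpolation_error)
            show "(z has_vector_derivative z' u) (at u within {t j..t (Suc j)})"
              if "u \<in> {t j..t (Suc j)}" for u
              using z'[of u] that cell by (blast intro: has_vector_derivative_within_subset)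
            show "norm (z' u - z' v) \<le> M2 * \<bar>u - v\<bar>"
              if "u \<in> {t j..t (Suc j)}" "v \<in> {t j..t (Suc j)}" for u v
              using that cell by (intro z'_lip) auto
          qed (use M2 j in auto)
          then show "norm (g (\<tau>, x \<tau>) - (((t (Suc j) - \<tau>) / (t (Suc j) - t j)) *\<^sub>R g (t j, x (t j))
               + ((\<tau> - t j) / (t (Suc j) - t j)) *\<^sub>R g (t (Suc j), x (t (Suc j))))) \<le> M2 * h\<^sup>2"
            unfolding width z_def .
        next
          fix i u assume "i \<le> k"
          then have "dist (g (t i, x (t i))) (g (t i, u)) \<le> L * dist (t i, x (t i)) (t i, u)"
            using t_in by (intro lipschitz_onD[OF g_lip]) auto
          then show "norm (g (t i, x (t i)) - g (t i, u)) \<le> L * norm (x (t i) - u)"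
            by (simp add: dist_Pair_Pair dist_norm)
        next
          fix i assume "i < k"
          then show "norm (x (t i) - abm \<alpha> psi psi' g t x0 i) \<le> E"
            using less.IH[of i] t_le[of i] by (simp add: t_def E_def)
        qed (use t0 L E in auto)
      qed
      also have "\<dots> \<le> (M2 * h\<^sup>2) * q T + L * E * q T
             + \<nu> * L * ((M1 * h) * q T + L * E * q T)"
      proof -
        have "q (t k) \<le> q T" using t_in[of k] t_le[of k] by (intro q_mono) auto
        moreover have "0 \<le> \<nu>" using \<alpha> G by (simp add: \<nu>_def)
        ultimately show ?thesis using M1 M2 h L E
          by (intro add_mono mult_left_mono) auto
      qed
      also have "\<dots> = (M2 * h\<^sup>2) * q T + \<nu> * (L * M1 * q T * h) + (L * q T) * E
             + (L * \<nu>) * ((L * q T) * E)"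
        by (simp add: algebra_simps)
      \<comment> \<open>The diagonal weight \<open>\<nu>\<close> is used twice: it is of order \<open>h powr \<alpha>\<close> next to the predictor's own
        error, while next to the propagated error the smallness \<open>L * \<nu> \<le> L * q T \<le> 1/4\<close> suffices.\<close>
      also have "\<dots> \<le> (M2 * ((T - a) powr (1 - \<alpha>) * h powr (1 + \<alpha>))) * q T
             + (d * h powr \<alpha>) * (L * M1 * q T * h) + (1 / 4) * E + (1 / 4) * ((1 / 4) * E)"
      proof (intro add_mono mult_left_mono mult_right_mono mult_mono)
        have "h\<^sup>2 = h powr (1 - \<alpha>) * h powr (1 + \<alpha>)"
          using h by (simp add: powr_numeral flip: powr_add)
        also have "\<dots> \<le> (T - a) powr (1 - \<alpha>) * h powr (1 + \<alpha>)"
          using h hT \<alpha> by (intro mult_right_mono powr_mono2) auto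
        finally show "h\<^sup>2 \<le> (T - a) powr (1 - \<alpha>) * h powr (1 + \<alpha>)" .
        have k1: "t (k - 1) \<le> t k" using t_mono by (simp add: strict_mono_less_eq)
        have psi_incr: "0 \<le> psi (t k) - psi (t (k - 1))"
          using psi_le[OF _ k1] t_in[of "k - 1"] by auto
        have "t k - t (k - 1) = h" using k by (simp add: t_eq of_nat_diff algebra_simps)
        then have "psi (t k) - psi (t (k - 1)) \<le> D * h"
          using psi_lip[OF t_in[of k] t_in[of "k - 1"]] h by auto
        then have "(psi (t k) - psi (t (k - 1))) powr \<alpha> \<le> (D * h) powr \<alpha>"
          using psi_incr \<alpha> by (intro powr_mono2) auto
        then show "\<nu> \<le> d * h powr \<alpha>"
          using D h \<alpha> G by (simp add: \<nu>_def d_def powr_mult divide_simps)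
        have "psi (t k) - psi (t (k - 1)) \<le> psi T - psi a"
          using psi_le[of "t k" T] psi_le[of a "t (k - 1)"] t_in[of k] t_in[of "k - 1"] t_le[of k] by auto
        then have "\<nu> \<le> q T" unfolding \<nu>_def q_def using \<alpha> G psi_incr
          by (intro divide_right_mono powr_mono2) auto
        then show "L * \<nu> \<le> 1 / 4" using T(3) mult_left_mono[OF _ L] by fastforce
      qed (use M1 M2 L E T h q_nonneg d in auto)
      also have "\<dots> = A * h powr (1 + \<alpha>) + (5 / 16) * E"
        using h by (simp add: A_def powr_add algebra_simps)
      also have "\<dots> \<le> E" using A by (simp add: E_def)
      finally show ?thesis by (simp add: t_def E_def)
    qed
  qed
  then show ?thesis using T by (intro bexI[of _ T] exI[of _ "2 * A"]) auto
qed

end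

theorem theorem6p2:
  fixes \<alpha> t0 T0 :: real
    and psi psi' :: "real \<Rightarrow> real"
    and g :: "real \<times> (real^'d) \<Rightarrow> real^'d"
    and x :: "real \<Rightarrow> real^'d"
    and x0 :: "real^'d"
  assumes alpha: "0 < \<alpha>" "\<alpha> \<le> 1"
    and t0: "t0 = 0"
    and T0: "t0 < T0"
    and psi_nonneg: "\<And>t. t \<ge> t0 \<Longrightarrow> psi t \<ge> 0"
    and psi_strict_mono: "strict_mono_on {t0..} psi"
    and psi_has_deriv: "\<And>t. t \<ge> t0 \<Longrightarrow> (psi has_real_derivative psi' t) (at t within {t0..})"
    and psi'_cont: "continuous_on {t0..} psi'"
    and psi'_pos: "\<And>t. t \<ge> t0 \<Longrightarrow> psi' t > 0"
    and g_lipschitz: "\<exists>L. L-lipschitz_on ({t0..T0} \<times> UNIV) g"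
    and x_solution: "psi_caputo_solution \<alpha> psi psi' g t0 T0 x0 x"
    and g_C2: "C2_on {t0..T0} (\<lambda>t. g (t, x t))"
  shows "\<exists>T\<in>{t0<..T0}. \<exists>C. \<forall>h>0. \<forall>k. uniform_grid t0 h k \<le> T \<longrightarrow>
           norm (x (uniform_grid t0 h k) - abm \<alpha> psi psi' g (uniform_grid t0 h) x0 k)
             \<le> C * h powr (1 + \<alpha>)"
proof -
  interpret time_change t0 psi psi'
    by unfold_locales (fact psi_strict_mono psi_has_deriv psi'_cont psi'_pos)+
  obtain L where "L-lipschitz_on ({t0..T0} \<times> UNIV) g" using g_lipschitz by blast
  then show ?thesis using abm_error_bound alpha T0 x_solution g_C2 by blast
qed

end
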